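(* Let $k$ be a commutative ring, $G$ a group, $C$ a small $k$-category with a finite number of objects, and $\alpha$ a partial action of $G$ on $C$. Then $G$ acts partially on the $k$-algebra $a(C)=\bigoplus_{x,y\in C_0}{}_yC_x$ (via the induced partial action, again denoted $\alpha$), and the (not necessarily associative) $k$-algebras $a(C*_\alpha G)$ and $a(C)*_\alpha G$ are isomorphic.
   Context: Categories. A small weak not necessarily associative (WNNA) $k$-category $D$ consists of a set $D_0$ of objects, a $k$-module ${}_yD_x$ of morphisms from $x$ to $y$ for all $x,y\in D_0$, and $k$-bilinear compositions ${}_zD_y\times{}_yD_x\to{}_zD_x$. If composition is associative and identities ${}_x1_x\in{}_xD_x$ exist it is a $k$-category; if composition is associative (identities not required) it is a weak $k$-category. An ideal $I$ of a $k$-category $C$ is a family of $k$-submodules ${}_yI_x\subseteq{}_yC_x$ closed under composition on either side with arbitrary morphisms of $C$. Algebra of a category. If $D$ is a WNNA $k$-category with finitely many objects, $a(D)=\bigoplus_{x,y\in D_0}{}_yD_x$ with matrix operations: the product of $f\in{}_zD_{y'}$ and $l\in{}_yD_x$ is $f\circ l$ if $y=y'$ and $0$ otherwise. Partial action on a set. A partial action of $G$ (with identity $e$) on a set $X$ is a family of subsets $S_g\subseteq X$ and bijections $\alpha_g:S_{g^{-1}}\to S_g$ ($g\in G$) with $S_e=X$, $\alpha_e=\mathrm{id}_X$, $S_{(gh)^{-1}}\supseteq\alpha_h^{-1}(S_h\cap S_{g^{-1}})$, and $\alpha_g(\alpha_h(x))=\alpha_{gh}(x)$ for $x\in\alpha_h^{-1}(S_h\cap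 S_{g^{-1}})$. A partial action of $G$ on a $k$-algebra $R$ is such a family on the set $R$ where moreover every $S_g$ is an ideal of $R$ and every $\alpha_g$ is an isomorphism of algebras. The partial skew group algebra $R*_\alpha G$ is the set of finite formal sums $\sum_{g}a_gu_g$, $a_g\in S_g$, with the usual addition and multiplication determined by $(a_gu_g)(b_hu_h)=\alpha_g(\alpha_{g^{-1}}(a_g)b_h)u_{gh}$; it need not be associative. Partial action on a category. A partial action $\alpha=\{\alpha^g\mid g\in G\}$ of $G$ on $C$ consists of: (i) a partial action $\alpha_0$ of $G$ on the set $C_0$, with subsets $C_0^g$ and bijections $C_0^{g^{-1}}\to C_0^g$ written $x\mapsto gx$; (ii) for each $g\in G$ an ideal $\mathcal{I}^g$ of $C$ such that ${}_a\mathcal{I}^g_b=0$ if $a\notin C_0^g$ or $b\notin C_0^g$; (iii) for each $g$ an equivalence $\alpha^g:\mathcal{I}^{g^{-1}}\to\mathcal{I}^g$ of weak categories, i.e. $k$-module isomorphisms $\alpha^g:{}_y\mathcal{I}_x^{g^{-1}}\to{}_{gy}\mathcal{I}_{gx}^g$ for $x,y\in C_0^{g^{-1}}$ compatible with composition; such that (iv) $\mathcal{I}^e=C$ and $\alpha^e=\mathrm{id}$; (v) for all $g,h\in G$ and $x,y\in C_0^h$, $\alpha^{h^{-1}}({}_y\mathcal{I}_x^h\cap{}_y\mathcal{I}_x^{g^{-1}})\subseteq{}_{h^{-1}y}\mathcal{I}_{h^{-1}x}^{(gh)^{-1}}$; (vi) if $x,y\in C_0^h\cap C_0^{g^{-1}}$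 and $f\in\alpha^{h^{-1}}({}_y\mathcal{I}_x^h\cap{}_y\mathcal{I}_x^{g^{-1}})$, then $\alpha^g(\alpha^h(f))=\alpha^{gh}(f)$. Skew category. $C*_\alpha G$ is the WNNA $k$-category with object set $C_0$ and morphisms ${}_y(C*_\alpha G)_x=\bigoplus_{g\in G}{}_y\mathcal{I}^g_{gx}$ (the summand being $0$ when $x\notin C_0^{g^{-1}}$, so that $gx$ is undefined), with composition determined, for $f\in{}_z\mathcal{I}^t_{ty}$ and $l\in{}_y\mathcal{I}^g_{gx}$, by $fl=\alpha^t(\alpha^{t^{-1}}(f)\circ l)\in{}_z\mathcal{I}^{tg}_{(tg)x}$. It need not be associative. Induced partial action on $a(C)$: the ideals are $a(C)_g=\bigoplus_{x,y\in C_0}{}_y\mathcal{I}_x^g$, and $\alpha_g:a(C)_{g^{-1}}\to a(C)_g$ is the $k$-linear map whose restriction to ${}_y\mathcal{I}_x^{g^{-1}}$, $x,y\in C_0^{g^{-1}}$, is $\alpha^g$. *)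

theory Defs
  imports "HOL-Algebra.Module" "HOL-Algebra.Ideal"
begin

section \<open>Modules and not necessarily associative algebras\<close>

definition module_iso ::
  "('k, 'c) ring_scheme \<Rightarrow> ('k, 'a, 'p) module_scheme \<Rightarrow> ('k, 'b, 'q) module_scheme \<Rightarrow> ('a \<Rightarrow> 'b) \<Rightarrow> bool"
  where "module_iso K M N \<phi> \<longleftrightarrow>
    bij_betw \<phi> (carrier M) (carrier N) \<and>
    (\<forall>a\<in>carrier M. \<forall>b\<in>carrier M. \<phi> (a \<oplus>\<^bsub>M\<^esub> b) = \<phi> a \<oplus>\<^bsub>N\<^esub> \<phi> b) \<and>
    (\<forall>c\<in>carrier K. \<forall>a\<in>carrier M. \<phi> (c \<odot>\<^bsub>M\<^esub> a) = c \<odot>\<^bsub>N\<^esub> \<phi> a)"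

text \<open>
  Elements of a direct sum are the finitely supported families, extensional outside the index set.
  The ring multiplication and unit fields of a mere module are never used.
\<close>

definition direct_sum :: "'i set \<Rightarrow> ('i \<Rightarrow> ('k, 'm, 'p) module_scheme) \<Rightarrow> ('k, 'i \<Rightarrow> 'm) module"
  where "direct_sum J M =
    \<lparr>carrier = {F \<in> (\<Pi>\<^sub>E i\<in>J. carrier (M i)). finite {i \<in> J. F i \<noteq> \<zero>\<^bsub>M i\<^esub>}},
     monoid.mult = undefined,
     one = undefined,
     ring.zero = (\<lambda>i\<in>J. \<zero>\<^bsub>M i\<^esub>),
     ring.add = (\<lambda>F F'. \<lambda>i\<in>J. F i \<oplus>\<^bsub>M i\<^esub> F' i),
     smult = (\<lambda>c F. \<lambda>i\<in>J. c \<odot>\<^bsub>M i\<^esub> F i)\<rparr>"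

text \<open>No associativity and no unit: the unit field of the record plays no role here.\<close>

locale nonassoc_algebra = module K A for K (structure) and A (structure) +
  assumes mult_closed: "\<lbrakk>a \<in> carrier A; b \<in> carrier A\<rbrakk> \<Longrightarrow> a \<otimes>\<^bsub>A\<^esub> b \<in> carrier A"
    and mult_add_left: "\<lbrakk>a \<in> carrier A; a' \<in> carrier A; b \<in> carrier A\<rbrakk> \<Longrightarrow>
      (a \<oplus>\<^bsub>A\<^esub> a') \<otimes>\<^bsub>A\<^esub> b = (a \<otimes>\<^bsub>A\<^esub> b) \<oplus>\<^bsub>A\<^esub> (a' \<otimes>\<^bsub>A\<^esub> b)"
    and mult_add_right: "\<lbrakk>a \<in> carrier A; b \<in> carrier A; b' \<in> carrier A\<rbrakk> \<Longrightarrow>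
      a \<otimes>\<^bsub>A\<^esub> (b \<oplus>\<^bsub>A\<^esub> b') = (a \<otimes>\<^bsub>A\<^esub> b) \<oplus>\<^bsub>A\<^esub> (a \<otimes>\<^bsub>A\<^esub> b')"
    and mult_smult_left: "\<lbrakk>c \<in> carrier K; a \<in> carrier A; b \<in> carrier A\<rbrakk> \<Longrightarrow>
      (c \<odot>\<^bsub>A\<^esub> a) \<otimes>\<^bsub>A\<^esub> b = c \<odot>\<^bsub>A\<^esub> (a \<otimes>\<^bsub>A\<^esub> b)"
    and mult_smult_right: "\<lbrakk>c \<in> carrier K; a \<in> carrier A; b \<in> carrier A\<rbrakk> \<Longrightarrow>
      a \<otimes>\<^bsub>A\<^esub> (c \<odot>\<^bsub>A\<^esub> b) = c \<odot>\<^bsub>A\<^esub> (a \<otimes>\<^bsub>A\<^esub> b)"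

text \<open>
  The library's locale \<open>algebra\<close> is commutative; here an algebra is associative and unital, but
  need not commute.
\<close>

definition k_algebra :: "('k, 'c) ring_scheme \<Rightarrow> ('k, 'a, 'p) module_scheme \<Rightarrow> bool"
  where "k_algebra K A \<longleftrightarrow> nonassoc_algebra K A \<and> ring A"

definition algebra_iso ::
  "('k, 'c) ring_scheme \<Rightarrow> ('k, 'a, 'p) module_scheme \<Rightarrow> ('k, 'b, 'q) module_scheme \<Rightarrow> ('a \<Rightarrow> 'b) \<Rightarrow> bool"
  where "algebra_iso K A B \<phi> \<longleftrightarrow>
    module_iso K A B \<phi> \<and>
    (\<forall>a\<in>carrier A. \<forall>b\<in>carrier A. \<phi> (a \<otimes>\<^bsub>A\<^esub> b) = \<phi> a \<otimes>\<^bsub>B\<^esub> \<phi> b)"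

definition algebras_isomorphic ::
  "('k, 'c) ring_scheme \<Rightarrow> ('k, 'a, 'p) module_scheme \<Rightarrow> ('k, 'b, 'q) module_scheme \<Rightarrow> bool"
  where "algebras_isomorphic K A B \<longleftrightarrow> (\<exists>\<phi>. algebra_iso K A B \<phi>)"


section \<open>Categories\<close>

text \<open>
  Following the notation \<open>\<^sub>yD\<^sub>x\<close>, \<open>Hom D y x\<close> is the module of morphisms from \<open>x\<close> to \<open>y\<close>, and
  \<open>Comp D z y x\<close> composes \<open>f \<in> \<^sub>zD\<^sub>y\<close> with \<open>l \<in> \<^sub>yD\<^sub>x\<close>. Morphism modules of different pairs of objects
  may overlap as sets, so composition carries the objects.
\<close>

record ('o, 'k, 'm) wnna_cat =
  Obj :: "'o set"
  Hom :: "'o \<Rightarrow> 'o \<Rightarrow> ('k, 'm) module"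
  Comp :: "'o \<Rightarrow> 'o \<Rightarrow> 'o \<Rightarrow> 'm \<Rightarrow> 'm \<Rightarrow> 'm"

locale wnna_category =
  fixes K :: "('k, 'c) ring_scheme" and D :: "('o, 'k, 'm) wnna_cat"
  assumes base_cring: "cring K"
    and Hom_module: "\<lbrakk>x \<in> Obj D; y \<in> Obj D\<rbrakk> \<Longrightarrow> module K (Hom D y x)"
    and Comp_closed: "\<lbrakk>x \<in> Obj D; y \<in> Obj D; z \<in> Obj D; f \<in> carrier (Hom D z y); l \<in> carrier (Hom D y x)\<rbrakk>
      \<Longrightarrow> Comp D z y x f l \<in> carrier (Hom D z x)"
    and Comp_add_left: "\<lbrakk>x \<in> Obj D; y \<in> Obj D; z \<in> Obj D;
        f \<in> carrier (Hom D z y); f' \<in> carrier (Hom D z y); l \<in> carrier (Hom D y x)\<rbrakk>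
      \<Longrightarrow> Comp D z y x (f \<oplus>\<^bsub>Hom D z y\<^esub> f') l = Comp D z y x f l \<oplus>\<^bsub>Hom D z x\<^esub> Comp D z y x f' l"
    and Comp_add_right: "\<lbrakk>x \<in> Obj D; y \<in> Obj D; z \<in> Obj D;
        f \<in> carrier (Hom D z y); l \<in> carrier (Hom D y x); l' \<in> carrier (Hom D y x)\<rbrakk>
      \<Longrightarrow> Comp D z y x f (l \<oplus>\<^bsub>Hom D y x\<^esub> l') = Comp D z y x f l \<oplus>\<^bsub>Hom D z x\<^esub> Comp D z y x f l'"
    and Comp_smult_left: "\<lbrakk>x \<in> Obj D; y \<in> Obj D; z \<in> Obj D; c \<in> carrier K;
        f \<in> carrier (Hom D z y); l \<in> carrier (Hom D y x)\<rbrakk>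
      \<Longrightarrow> Comp D z y x (c \<odot>\<^bsub>Hom D z y\<^esub> f) l = c \<odot>\<^bsub>Hom D z x\<^esub> Comp D z y x f l"
    and Comp_smult_right: "\<lbrakk>x \<in> Obj D; y \<in> Obj D; z \<in> Obj D; c \<in> carrier K;
        f \<in> carrier (Hom D z y); l \<in> carrier (Hom D y x)\<rbrakk>
      \<Longrightarrow> Comp D z y x f (c \<odot>\<^bsub>Hom D y x\<^esub> l) = c \<odot>\<^bsub>Hom D z x\<^esub> Comp D z y x f l"

definition is_identity :: "('o, 'k, 'm) wnna_cat \<Rightarrow> 'o \<Rightarrow> 'm \<Rightarrow> bool"
  where "is_identity D x i \<longleftrightarrow> i \<in> carrier (Hom D x x) \<and>
    (\<forall>y\<in>Obj D. \<forall>f\<in>carrier (Hom D y x). Comp D y x x f i = f) \<and>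
    (\<forall>y\<in>Obj D. \<forall>f\<in>carrier (Hom D x y). Comp D x x y i f = f)"

locale k_category = wnna_category K C
  for K :: "('k, 'c) ring_scheme" and C :: "('o, 'k, 'm) wnna_cat" +
  assumes Comp_assoc: "\<lbrakk>w \<in> Obj C; x \<in> Obj C; y \<in> Obj C; z \<in> Obj C;
        f \<in> carrier (Hom C z y); l \<in> carrier (Hom C y x); h \<in> carrier (Hom C x w)\<rbrakk>
      \<Longrightarrow> Comp C z x w (Comp C z y x f l) h = Comp C z y w f (Comp C y x w l h)"
    and identities: "x \<in> Obj C \<Longrightarrow> \<exists>i. is_identity C x i"

definition category_ideal ::
  "('k, 'c) ring_scheme \<Rightarrow> ('o, 'k, 'm) wnna_cat \<Rightarrow> ('o \<Rightarrow> 'o \<Rightarrow> 'm set) \<Rightarrow> bool"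
  where "category_ideal K C I \<longleftrightarrow>
    (\<forall>x\<in>Obj C. \<forall>y\<in>Obj C. submodule (I y x) K (Hom C y x)) \<and>
    (\<forall>x\<in>Obj C. \<forall>y\<in>Obj C. \<forall>z\<in>Obj C. \<forall>f\<in>carrier (Hom C z y). \<forall>l\<in>I y x. Comp C z y x f l \<in> I z x) \<and>
    (\<forall>x\<in>Obj C. \<forall>y\<in>Obj C. \<forall>z\<in>Obj C. \<forall>f\<in>I z y. \<forall>l\<in>carrier (Hom C y x). Comp C z y x f l \<in> I z x)"

text \<open>
  The algebra \<open>a(D)\<close>: matrices with the entry at \<open>(y, x)\<close> in \<open>\<^sub>yD\<^sub>x\<close>. The unit field is the identity
  matrix; it is meaningful only when identities (which are then unique) exist.
\<close>

definition cat_algebra :: "('o, 'k, 'm) wnna_cat \<Rightarrow> ('k, 'o \<times> 'o \<Rightarrow> 'm) module"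
  where "cat_algebra D =
    (direct_sum (Obj D \<times> Obj D) (\<lambda>(y, x). Hom D y x))
    \<lparr>monoid.mult := (\<lambda>F L. \<lambda>(z, x) \<in> Obj D \<times> Obj D.
        finsum (Hom D z x) (\<lambda>y. Comp D z y x (F (z, y)) (L (y, x))) (Obj D)),
     one := (\<lambda>(y, x) \<in> Obj D \<times> Obj D.
        if y = x then (THE i. is_identity D x i) else \<zero>\<^bsub>Hom D y x\<^esub>)\<rparr>"


section \<open>Partial actions\<close>

definition partial_action_set ::
  "('g, 'd) monoid_scheme \<Rightarrow> 'a set \<Rightarrow> ('g \<Rightarrow> 'a set) \<Rightarrow> ('g \<Rightarrow> 'a \<Rightarrow> 'a) \<Rightarrow> bool"
  where "partial_action_set G A S \<alpha> \<longleftrightarrow>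
    (\<forall>g\<in>carrier G. S g \<subseteq> A \<and> bij_betw (\<alpha> g) (S (inv\<^bsub>G\<^esub> g)) (S g)) \<and>
    S \<one>\<^bsub>G\<^esub> = A \<and> (\<forall>x\<in>A. \<alpha> \<one>\<^bsub>G\<^esub> x = x) \<and>
    (\<forall>g\<in>carrier G. \<forall>h\<in>carrier G. \<forall>x\<in>S (inv\<^bsub>G\<^esub> h). \<alpha> h x \<in> S h \<inter> S (inv\<^bsub>G\<^esub> g) \<longrightarrow>
       x \<in> S (inv\<^bsub>G\<^esub> (g \<otimes>\<^bsub>G\<^esub> h)) \<and> \<alpha> g (\<alpha> h x) = \<alpha> (g \<otimes>\<^bsub>G\<^esub> h) x)"

definition partial_action_algebra ::
  "('k, 'c) ring_scheme \<Rightarrow> ('g, 'd) monoid_scheme \<Rightarrow> ('k, 'a, 'p) module_scheme \<Rightarrow>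
   ('g \<Rightarrow> 'a set) \<Rightarrow> ('g \<Rightarrow> 'a \<Rightarrow> 'a) \<Rightarrow> bool"
  where "partial_action_algebra K G R S \<alpha> \<longleftrightarrow>
    k_algebra K R \<and>
    partial_action_set G (carrier R) S \<alpha> \<and>
    (\<forall>g\<in>carrier G. ideal (S g) R \<and> submodule (S g) K R) \<and>
    (\<forall>g\<in>carrier G. algebra_iso K (R\<lparr>carrier := S (inv\<^bsub>G\<^esub> g)\<rparr>) (R\<lparr>carrier := S g\<rparr>) (\<alpha> g))"

text \<open>
  \<open>\<Sum>\<^sub>g a\<^sub>g u\<^sub>g\<close> is encoded as the family \<open>g \<mapsto> a\<^sub>g\<close>. In the product, only pairs in the (finite)
  supports are summed over, since \<open>finsum\<close> is meaningful for finite index sets only.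
\<close>

definition partial_skew_group_algebra ::
  "('g, 'd) monoid_scheme \<Rightarrow> ('k, 'a, 'p) module_scheme \<Rightarrow> ('g \<Rightarrow> 'a set) \<Rightarrow> ('g \<Rightarrow> 'a \<Rightarrow> 'a) \<Rightarrow>
   ('k, 'g \<Rightarrow> 'a) module"
  where "partial_skew_group_algebra G R S \<alpha> =
    (direct_sum (carrier G) (\<lambda>g. R\<lparr>carrier := S g\<rparr>))
    \<lparr>monoid.mult := (\<lambda>a b. \<lambda>s \<in> carrier G.
        finsum R (\<lambda>(g, h). \<alpha> g (\<alpha> (inv\<^bsub>G\<^esub> g) (a g) \<otimes>\<^bsub>R\<^esub> b h))
          {(g, h). g \<in> carrier G \<and> h \<in> carrier G \<and> a g \<noteq> \<zero>\<^bsub>R\<^esub> \<and> b h \<noteq> \<zero>\<^bsub>R\<^esub> \<and> g \<otimes>\<^bsub>G\<^esub> h = s}),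
     one := (\<lambda>g \<in> carrier G. if g = \<one>\<^bsub>G\<^esub> then \<one>\<^bsub>R\<^esub> else \<zero>\<^bsub>R\<^esub>)\<rparr>"

text \<open>
  The data of a partial action on a category: \<open>Dom \<alpha> g\<close> is \<open>C\<^sub>0\<^sup>g\<close>, \<open>act \<alpha> g x\<close> is \<open>gx\<close>,
  \<open>Ideal_at \<alpha> g y x\<close> is the component of the ideal at \<open>(y, x)\<close>, and \<open>mor \<alpha> g y x\<close> is \<open>\<alpha>\<^sup>g\<close> on
  the component at \<open>(y, x)\<close> of the ideal of the inverse of \<open>g\<close>.
\<close>

record ('g, 'o, 'm) partial_action_data =
  Dom :: "'g \<Rightarrow> 'o set"
  act :: "'g \<Rightarrow> 'o \<Rightarrow> 'o"
  Ideal_at :: "'g \<Rightarrow> 'o \<Rightarrow> 'o \<Rightarrow> 'm set"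
  mor :: "'g \<Rightarrow> 'o \<Rightarrow> 'o \<Rightarrow> 'm \<Rightarrow> 'm"

locale partial_action_category = k_category K C + group G
  for K :: "('k, 'c) ring_scheme" and G :: "('g, 'd) monoid_scheme" (structure)
    and C :: "('o, 'k, 'm) wnna_cat" and \<alpha> :: "('g, 'o, 'm) partial_action_data" +
  assumes objects: "partial_action_set G (Obj C) (Dom \<alpha>) (act \<alpha>)"
    and ideals: "g \<in> carrier G \<Longrightarrow> category_ideal K C (Ideal_at \<alpha> g)"
    and ideals_zero: "\<lbrakk>g \<in> carrier G; a \<in> Obj C; b \<in> Obj C; a \<notin> Dom \<alpha> g \<or> b \<notin> Dom \<alpha> g\<rbrakk>
      \<Longrightarrow> Ideal_at \<alpha> g a b = {\<zero>\<^bsub>Hom C a b\<^esub>}"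
    and mor_iso: "\<lbrakk>g \<in> carrier G; x \<in> Dom \<alpha> (inv g); y \<in> Dom \<alpha> (inv g)\<rbrakk>
      \<Longrightarrow> module_iso K
            ((Hom C y x)\<lparr>carrier := Ideal_at \<alpha> (inv g) y x\<rparr>)
            ((Hom C (act \<alpha> g y) (act \<alpha> g x))\<lparr>carrier := Ideal_at \<alpha> g (act \<alpha> g y) (act \<alpha> g x)\<rparr>)
            (mor \<alpha> g y x)"
    and mor_Comp: "\<lbrakk>g \<in> carrier G; x \<in> Dom \<alpha> (inv g); y \<in> Dom \<alpha> (inv g); z \<in> Dom \<alpha> (inv g);
        f \<in> Ideal_at \<alpha> (inv g) z y; l \<in> Ideal_at \<alpha> (inv g) y x\<rbrakk>
      \<Longrightarrow> mor \<alpha> g z x (Comp C z y x f l) =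
          Comp C (act \<alpha> g z) (act \<alpha> g y) (act \<alpha> g x) (mor \<alpha> g z y f) (mor \<alpha> g y x l)"
    and Ideal_at_one: "\<lbrakk>x \<in> Obj C; y \<in> Obj C\<rbrakk> \<Longrightarrow> Ideal_at \<alpha> \<one> y x = carrier (Hom C y x)"
    and mor_one: "\<lbrakk>x \<in> Obj C; y \<in> Obj C; f \<in> carrier (Hom C y x)\<rbrakk> \<Longrightarrow> mor \<alpha> \<one> y x f = f"
    and mor_inv_image: "\<lbrakk>g \<in> carrier G; h \<in> carrier G; x \<in> Dom \<alpha> h; y \<in> Dom \<alpha> h\<rbrakk>
      \<Longrightarrow> mor \<alpha> (inv h) y x ` (Ideal_at \<alpha> h y x \<inter> Ideal_at \<alpha> (inv g) y x)
          \<subseteq> Ideal_at \<alpha> (inv (g \<otimes> h)) (act \<alpha> (inv h) y) (act \<alpha> (inv h) x)"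
    and mor_mult: "\<lbrakk>g \<in> carrier G; h \<in> carrier G; x \<in> Dom \<alpha> h \<inter> Dom \<alpha> (inv g); y \<in> Dom \<alpha> h \<inter> Dom \<alpha> (inv g);
        f \<in> mor \<alpha> (inv h) y x ` (Ideal_at \<alpha> h y x \<inter> Ideal_at \<alpha> (inv g) y x)\<rbrakk>
      \<Longrightarrow> mor \<alpha> g y x (mor \<alpha> h (act \<alpha> (inv h) y) (act \<alpha> (inv h) x) f) =
          mor \<alpha> (g \<otimes> h) (act \<alpha> (inv h) y) (act \<alpha> (inv h) x) f"


section \<open>The skew category and the induced partial action\<close>

text \<open>
  A morphism from \<open>x\<close> to \<open>y\<close> is a family indexed by the \<open>g\<close> for which \<open>gx\<close> is defined; the other
  summands are zero and are omitted. In the product of \<open>F t\<close> and \<open>L g\<close>, if \<open>z\<close> is not in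
  \<open>C\<^sub>0\<^sup>t\<close>, or \<open>gx\<close> is not in the domain of \<open>t\<close>, then the elements \<open>\<alpha>\<close> is to be applied to lie in a
  zero component of an ideal, whence the value zero.
\<close>

definition defined_at :: "('g, 'd) monoid_scheme \<Rightarrow> ('g, 'o, 'm) partial_action_data \<Rightarrow> 'o \<Rightarrow> 'g set"
  where "defined_at G \<alpha> x = {g \<in> carrier G. x \<in> Dom \<alpha> (inv\<^bsub>G\<^esub> g)}"

definition skew_comp ::
  "('g, 'd) monoid_scheme \<Rightarrow> ('o, 'k, 'm) wnna_cat \<Rightarrow> ('g, 'o, 'm) partial_action_data \<Rightarrow>
   'o \<Rightarrow> 'o \<Rightarrow> 'o \<Rightarrow> 'g \<Rightarrow> 'g \<Rightarrow> 'm \<Rightarrow> 'm \<Rightarrow> 'm"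
  where "skew_comp G C \<alpha> z y x t g f l =
    (if z \<in> Dom \<alpha> t \<and> act \<alpha> g x \<in> Dom \<alpha> (inv\<^bsub>G\<^esub> t)
     then mor \<alpha> t (act \<alpha> (inv\<^bsub>G\<^esub> t) z) (act \<alpha> g x)
            (Comp C (act \<alpha> (inv\<^bsub>G\<^esub> t) z) y (act \<alpha> g x) (mor \<alpha> (inv\<^bsub>G\<^esub> t) z (act \<alpha> t y) f) l)
     else \<zero>\<^bsub>Hom C z (act \<alpha> (t \<otimes>\<^bsub>G\<^esub> g) x)\<^esub>)"

definition skew_category ::
  "('g, 'd) monoid_scheme \<Rightarrow> ('o, 'k, 'm) wnna_cat \<Rightarrow> ('g, 'o, 'm) partial_action_data \<Rightarrow>
   ('o, 'k, 'g \<Rightarrow> 'm) wnna_cat"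
  where "skew_category G C \<alpha> =
    \<lparr>Obj = Obj C,
     Hom = (\<lambda>y x. direct_sum (defined_at G \<alpha> x)
       (\<lambda>g. (Hom C y (act \<alpha> g x))\<lparr>carrier := Ideal_at \<alpha> g y (act \<alpha> g x)\<rparr>)),
     Comp = (\<lambda>z y x F L. \<lambda>s \<in> defined_at G \<alpha> x.
       finsum (Hom C z (act \<alpha> s x)) (\<lambda>(t, g). skew_comp G C \<alpha> z y x t g (F t) (L g))
         {(t, g). t \<in> defined_at G \<alpha> y \<and> g \<in> defined_at G \<alpha> x \<and>
            F t \<noteq> \<zero>\<^bsub>Hom C z (act \<alpha> t y)\<^esub> \<and> L g \<noteq> \<zero>\<^bsub>Hom C y (act \<alpha> g x)\<^esub> \<and> t \<otimes>\<^bsub>G\<^esub> g = s})\<rparr>"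

definition induced_ideal ::
  "('o, 'k, 'm) wnna_cat \<Rightarrow> ('g, 'o, 'm) partial_action_data \<Rightarrow> 'g \<Rightarrow> ('o \<times> 'o \<Rightarrow> 'm) set"
  where "induced_ideal C \<alpha> g =
    carrier (direct_sum (Obj C \<times> Obj C) (\<lambda>(y, x). (Hom C y x)\<lparr>carrier := Ideal_at \<alpha> g y x\<rparr>))"

text \<open>
  The linear extension of the maps \<open>\<alpha>\<^sup>g\<close>: the entry at \<open>(y, x)\<close> of \<open>F\<close>, for \<open>y\<close> and \<open>x\<close> in the domain of
  \<open>g\<close>, is sent by \<open>\<alpha>\<^sup>g\<close> to the position \<open>(gy, gx)\<close>, written \<open>(v, w)\<close> below; all other entries
  of \<open>F\<close>, and of its image, are zero.
\<close>

definition induced_map ::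
  "('g, 'd) monoid_scheme \<Rightarrow> ('o, 'k, 'm) wnna_cat \<Rightarrow> ('g, 'o, 'm) partial_action_data \<Rightarrow>
   'g \<Rightarrow> ('o \<times> 'o \<Rightarrow> 'm) \<Rightarrow> ('o \<times> 'o \<Rightarrow> 'm)"
  where "induced_map G C \<alpha> g F = (\<lambda>(v, w) \<in> Obj C \<times> Obj C.
    if v \<in> Dom \<alpha> g \<and> w \<in> Dom \<alpha> g
    then mor \<alpha> g (act \<alpha> (inv\<^bsub>G\<^esub> g) v) (act \<alpha> (inv\<^bsub>G\<^esub> g) w) (F (act \<alpha> (inv\<^bsub>G\<^esub> g) v, act \<alpha> (inv\<^bsub>G\<^esub> g) w))
    else \<zero>\<^bsub>Hom C v w\<^esub>)"

end

theory Submission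
  imports Defs
begin

text \<open>
  The isomorphism sends a matrix \<open>F\<close> over the skew category to \<open>\<Sum>\<^sub>g a\<^sub>g u\<^sub>g\<close>, where \<open>a\<^sub>g\<close> has the entry
  \<open>F (z, x) g\<close> at position \<open>(z, gx)\<close>. It is bijective because \<open>x \<mapsto> gx\<close> is a bijection between
  the domain and the range of \<open>g\<close> and the ideals vanish outside that range. In the product in
  \<open>a(C) * G\<close>, the sum over the intermediate object can be moved outside \<open>\<alpha>\<^sub>t\<close>; both products then
  become the same double sum over the intermediate object and the factorisations \<open>s = tg\<close>.
\<close>

section \<open>Sums and direct sums\<close>

text \<open>Three obstacles shape the argument. The first is definedness: gh can be defined at an
  object where h is not, or where g is not defined after h. The composition law for the induced maps
  then requires the entry of the matrix at such a position to vanish. Either the entry lies in a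
  zero component of the ideal of the inverse of h, or its image under the injective map of h lies in
  a zero component of the ideal of the inverse of g. Such vanishing is also what reconciles
  \<open>mor_Comp\<close>, which speaks only of objects in the domain, with matrix products, which
  run over all objects. The second is partial linearity: the maps of \<alpha> are additive only on
  ideals, while sums are formed in the surrounding modules. Hence the set \<open>H\<close> in the
  first lemma. The third is the form of the index sets: both products sum over supports of their
  factors, in the skew category even depending on the intermediate object. Distributivity and the
  exchange of sums become available only after these sets are enlarged to common finite ones by zero
  terms.\<close>

lemma finsum_additive:
  assumes M: "abelian_monoid M" and N: "abelian_monoid N"
    and H: "H \<subseteq> carrier M" "\<zero>\<^bsub>M\<^esub> \<in> H" "\<And>a b. \<lbrakk>a \<in> H; b \<in> H\<rbrakk> \<Longrightarrow> a \<oplus>\<^bsub>M\<^esub> b \<in> H"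
    and h: "\<And>a. a \<in> H \<Longrightarrow> h a \<in> carrier N" "h \<zero>\<^bsub>M\<^esub> = \<zero>\<^bsub>N\<^esub>"
      "\<And>a b. \<lbrakk>a \<in> H; b \<in> H\<rbrakk> \<Longrightarrow> h (a \<oplus>\<^bsub>M\<^esub> b) = h a \<oplus>\<^bsub>N\<^esub> h b"
    and f: "\<And>i. i \<in> A \<Longrightarrow> f i \<in> H"
  shows "finsum M f A \<in> H" and "h (finsum M f A) = finsum N (\<lambda>i. h (f i)) A"
proof -
  interpret M: abelian_monoid M by fact
  interpret N: abelian_monoid N by fact
  have "finsum M f A \<in> H \<and> h (finsum M f A) = finsum N (\<lambda>i. h (f i)) A"
    using f
  \<comment> \<open>For infinite \<open>A\<close> both sums are zero by convention, and
    \<open>h\<close> preserves zero, so no finiteness is assumed. With \<open>h\<close> the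
    identity, the first conclusion is closure of \<open>H\<close> under finite sums.\<close>
  proof (induction A rule: infinite_finite_induct)
    case (insert a A)
    have "finsum M f (insert a A) = f a \<oplus>\<^bsub>M\<^esub> finsum M f A"
      using insert.hyps insert.prems H(1) by (intro M.finsum_insert) auto
    moreover have "finsum N (\<lambda>i. h (f i)) (insert a A) = h (f a) \<oplus>\<^bsub>N\<^esub> finsum N (\<lambda>i. h (f i)) A"
      using insert.hyps insert.prems h(1) by (intro N.finsum_insert) auto
    ultimately show ?case using insert H(3) h(3) by simp
  qed (simp_all add: M.finsum_infinite N.finsum_infinite M.finsum_empty N.finsum_empty H h)
  then show "finsum M f A \<in> H" and "h (finsum M f A) = finsum N (\<lambda>i. h (f i)) A" by auto
qed

context abelian_monoid
begin

lemma finsum_zero_eqI: "(\<And>i. i \<in> A \<Longrightarrow> f i = \<zero>) \<Longrightarrow> finsum G f A = \<zero>"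
  by (rule add.finprod_one_eqI)

text \<open>A sum over an infinite set is zero, and a sum of zeros is zero, so the exchange is
  compatible with this convention and needs no finiteness.\<close>

lemma finsum_commute:
  assumes "\<And>i j. \<lbrakk>i \<in> A; j \<in> B\<rbrakk> \<Longrightarrow> f i j \<in> carrier G"
  shows "finsum G (\<lambda>i. finsum G (f i) B) A = finsum G (\<lambda>j. finsum G (\<lambda>i. f i j) A) B"
  using assms
proof (induction A rule: infinite_finite_induct)
  case (infinite A)
  then show ?case by (simp add: finsum_infinite finsum_zero)
next
  case empty
  then show ?case by (simp add: finsum_empty finsum_zero)
next
  case (insert a A)
  have "finsum G (\<lambda>i. finsum G (f i) B) (insert a A)
      = finsum G (f a) B \<oplus> finsum G (\<lambda>i. finsum G (f i) B) A"
    using insert by (intro finsum_insert) auto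
  also have "\<dots> = finsum G (f a) B \<oplus> finsum G (\<lambda>j. finsum G (\<lambda>i. f i j) A) B"
    using insert by simp
  also have "\<dots> = finsum G (\<lambda>j. f a j \<oplus> finsum G (\<lambda>i. f i j) A) B"
    using insert by (intro finsum_addf[symmetric]) (auto intro!: finsum_closed)
  also have "\<dots> = finsum G (\<lambda>j. finsum G (\<lambda>i. f i j) (insert a A)) B"
    using insert
    by (intro finsum_cong') (auto intro!: finsum_insert[symmetric] a_closed finsum_closed)
  finally show ?case .
qed

text \<open>This evaluates products with the unit matrix, where a row or a column contributes a
  single term.\<close>

lemma finsum_single_support:
  assumes "finite A" "i \<in> A" "f i \<in> carrier G" "\<And>j. \<lbrakk>j \<in> A; j \<noteq> i\<rbrakk> \<Longrightarrow> f j = \<zero>"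
  shows "finsum G f A = f i"
proof -
  have "finsum G f A = finsum G f {i}"
    using assms by (intro add.finprod_mono_neutral_cong_right) (auto, metis zero_closed)
  then show ?thesis using assms by (simp add: finsum_insert finsum_empty)
qed

text \<open>Passes from an index set that depends on the summands to a larger one that does not.
  Finiteness of \<open>B\<close> matters: a sum over an infinite set would collapse to zero.\<close>

lemma finsum_mono_neutral:
  assumes "finite B" "A \<subseteq> B" "\<And>i. i \<in> B - A \<Longrightarrow> f i = \<zero>" "\<And>i. i \<in> A \<Longrightarrow> f i \<in> carrier G"
  shows "finsum G f A = finsum G f B"
  using assms by (intro add.finprod_mono_neutral_cong_left) (auto, metis DiffI zero_closed)

end

lemma direct_sum_simps:
  "carrier (direct_sum J M) = {F \<in> (\<Pi>\<^sub>E i\<in>J. carrier (M i)). finite {i \<in> J. F i \<noteq> \<zero>\<^bsub>M i\<^esub>}}"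
  "\<zero>\<^bsub>direct_sum J M\<^esub> = (\<lambda>i\<in>J. \<zero>\<^bsub>M i\<^esub>)"
  "F \<oplus>\<^bsub>direct_sum J M\<^esub> F' = (\<lambda>i\<in>J. F i \<oplus>\<^bsub>M i\<^esub> F' i)"
  "c \<odot>\<^bsub>direct_sum J M\<^esub> F = (\<lambda>i\<in>J. c \<odot>\<^bsub>M i\<^esub> F i)"
  by (simp_all add: direct_sum_def)

text \<open>The slack in \<open>A\<close> allows for the multiplicative fields that algebra records override.\<close>

lemma module_direct_sum:
  assumes K: "cring K" and M: "\<And>i. i \<in> J \<Longrightarrow> module K (M i)"
    and A: "carrier A = carrier (direct_sum J M)" "\<zero>\<^bsub>A\<^esub> = \<zero>\<^bsub>direct_sum J M\<^esub>"
      "add A = add (direct_sum J M)" "smult A = smult (direct_sum J M)"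
  shows "module K A"
proof -
  note simps = A direct_sum_simps
  have ab: "abelian_group (M i)" if "i \<in> J" for i
    using M[OF that] by (rule module.axioms)
  note E = abelian_groupE[OF ab]
  \<comment> \<open>A pointwise operation that fixes zero has its support inside the union of the
    supports of its arguments. Sums, negatives and scalar multiples are all instances; the unary
    ones ignore the second argument.\<close>
  have fin: "finite {i \<in> J. h i (F i) (F' i) \<noteq> \<zero>\<^bsub>M i\<^esub>}"
    if "finite {i \<in> J. F i \<noteq> \<zero>\<^bsub>M i\<^esub>}" "finite {i \<in> J. F' i \<noteq> \<zero>\<^bsub>M i\<^esub>}"
      "\<And>i. i \<in> J \<Longrightarrow> h i \<zero>\<^bsub>M i\<^esub> \<zero>\<^bsub>M i\<^esub> = \<zero>\<^bsub>M i\<^esub>" for h F F'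
    by (rule finite_subset[OF _ finite_UnI[OF that(1,2)]]) (use that(3) in auto)
  have smult0: "c \<odot>\<^bsub>M i\<^esub> \<zero>\<^bsub>M i\<^esub> = \<zero>\<^bsub>M i\<^esub>" if "c \<in> carrier K" "i \<in> J" for c i
    using module.smult_r_null[OF M that(1)] that by simp
  have cl: "F i \<in> carrier (M i)" if "F \<in> carrier A" "i \<in> J" for F i
    using that by (auto simp: simps)
  show ?thesis
  proof (rule moduleI[OF K])
    show "abelian_group A"
    proof (rule abelian_groupI)
      fix F F' assume F: "F \<in> carrier A" "F' \<in> carrier A"
      show "F \<oplus>\<^bsub>A\<^esub> F' \<in> carrier A"
        using F fin[of F F' "\<lambda>i. add (M i)"] E(1,2,5) by (simp add: simps PiE_iff cong: conj_cong)
      show "F \<oplus>\<^bsub>A\<^esub> F' = F' \<oplus>\<^bsub>A\<^esub> F"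
        using F[THEN cl] E(4) by (auto simp: simps intro!: restrict_ext)
    next
      show "\<zero>\<^bsub>A\<^esub> \<in> carrier A"
        using E(2) by (simp add: simps PiE_iff cong: conj_cong)
    next
      fix F F' F'' assume F: "F \<in> carrier A" "F' \<in> carrier A" "F'' \<in> carrier A"
      show "F \<oplus>\<^bsub>A\<^esub> F' \<oplus>\<^bsub>A\<^esub> F'' = F \<oplus>\<^bsub>A\<^esub> (F' \<oplus>\<^bsub>A\<^esub> F'')"
        using F[THEN cl] E(3) by (auto simp: simps intro!: restrict_ext)
    next
      fix F assume F: "F \<in> carrier A"
      show "\<zero>\<^bsub>A\<^esub> \<oplus>\<^bsub>A\<^esub> F = F"
        using F E(5) by (auto simp: simps PiE_iff intro!: extensionalityI[of _ J])
      let ?N = "\<lambda>i\<in>J. \<ominus>\<^bsub>M i\<^esub> F i"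
      have "?N \<in> carrier A"
        using F fin[of F F "\<lambda>i a b. \<ominus>\<^bsub>M i\<^esub> a"] abelian_group.a_inv_closed[OF ab]
          abelian_group.minus_equality[OF ab] E(2,5) by (simp add: simps PiE_iff cong: conj_cong)
      moreover have "?N \<oplus>\<^bsub>A\<^esub> F = \<zero>\<^bsub>A\<^esub>"
        using F[THEN cl] abelian_group.l_neg[OF ab] by (auto simp: simps intro!: restrict_ext)
      ultimately show "\<exists>F'\<in>carrier A. F' \<oplus>\<^bsub>A\<^esub> F = \<zero>\<^bsub>A\<^esub>" by blast
    qed
  next
    fix c F assume c: "c \<in> carrier K" and F: "F \<in> carrier A"
    show "c \<odot>\<^bsub>A\<^esub> F \<in> carrier A"
      using F c fin[of F F "\<lambda>i a b. c \<odot>\<^bsub>M i\<^esub> a"] smult0 module.smult_closed[OF M]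
      by (simp add: simps PiE_iff cong: conj_cong)
  next
    fix c d F assume c: "c \<in> carrier K" "d \<in> carrier K" and F: "F \<in> carrier A"
    show "(c \<oplus>\<^bsub>K\<^esub> d) \<odot>\<^bsub>A\<^esub> F = c \<odot>\<^bsub>A\<^esub> F \<oplus>\<^bsub>A\<^esub> d \<odot>\<^bsub>A\<^esub> F"
      using cl[OF F] c module.smult_l_distr[OF M] by (auto simp: simps intro!: restrict_ext)
    show "(c \<otimes>\<^bsub>K\<^esub> d) \<odot>\<^bsub>A\<^esub> F = c \<odot>\<^bsub>A\<^esub> (d \<odot>\<^bsub>A\<^esub> F)"
      using cl[OF F] c module.smult_assoc1[OF M] by (auto simp: simps intro!: restrict_ext)
  next
    fix c F F' assume c: "c \<in> carrier K" and F: "F \<in> carrier A" "F' \<in> carrier A"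
    show "c \<odot>\<^bsub>A\<^esub> (F \<oplus>\<^bsub>A\<^esub> F') = c \<odot>\<^bsub>A\<^esub> F \<oplus>\<^bsub>A\<^esub> c \<odot>\<^bsub>A\<^esub> F'"
      using F[THEN cl] c module.smult_r_distr[OF M] by (auto simp: simps intro!: restrict_ext)
  next
    fix F assume F: "F \<in> carrier A"
    show "\<one>\<^bsub>K\<^esub> \<odot>\<^bsub>A\<^esub> F = F"
      using F module.smult_one[OF M] by (auto simp: simps PiE_iff intro!: extensionalityI[of _ J])
  qed
qed

section \<open>The algebra of a category\<close>

text \<open>
  A category whose composition is not known to be bilinear: bilinearity of the composition of the skew
  category is only obtained through the isomorphism with the partial skew group algebra.
\<close>

locale finite_module_graph =
  fixes K :: "('k, 'c) ring_scheme" and D :: "('o, 'k, 'm) wnna_cat"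
  assumes base_cring: "cring K"
    and finite_Obj: "finite (Obj D)"
    and Hom_module: "\<lbrakk>x \<in> Obj D; y \<in> Obj D\<rbrakk> \<Longrightarrow> module K (Hom D y x)"
    and Comp_closed: "\<lbrakk>x \<in> Obj D; y \<in> Obj D; z \<in> Obj D; f \<in> carrier (Hom D z y); l \<in> carrier (Hom D y x)\<rbrakk>
      \<Longrightarrow> Comp D z y x f l \<in> carrier (Hom D z x)"
begin

lemma Hom_abelian: "\<lbrakk>x \<in> Obj D; y \<in> Obj D\<rbrakk> \<Longrightarrow> abelian_group (Hom D y x)"
  using Hom_module module.axioms(2) by blast

lemma Hom_monoid: "\<lbrakk>x \<in> Obj D; y \<in> Obj D\<rbrakk> \<Longrightarrow> abelian_monoid (Hom D y x)"
  using Hom_abelian abelian_group.axioms(1) by blast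

lemma Hom_zero: "\<lbrakk>x \<in> Obj D; y \<in> Obj D\<rbrakk> \<Longrightarrow> \<zero>\<^bsub>Hom D y x\<^esub> \<in> carrier (Hom D y x)"
  using Hom_monoid abelian_monoid.zero_closed by blast

text \<open>There are finitely many pairs of objects, so the finite support demanded by the direct
  sum is automatic.\<close>

lemma cat_algebra_carrier:
  "F \<in> carrier (cat_algebra D) \<longleftrightarrow> F \<in> extensional (Obj D \<times> Obj D) \<and>
    (\<forall>y\<in>Obj D. \<forall>x\<in>Obj D. F (y, x) \<in> carrier (Hom D y x))"
  using finite_Obj by (auto simp: cat_algebra_def direct_sum_simps PiE_iff)

lemma cat_algebra_entry:
  "\<lbrakk>F \<in> carrier (cat_algebra D); y \<in> Obj D; x \<in> Obj D\<rbrakk> \<Longrightarrow> F (y, x) \<in> carrier (Hom D y x)"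
  by (simp add: cat_algebra_carrier)

lemma cat_algebra_eqI:
  assumes "F \<in> carrier (cat_algebra D)" "L \<in> carrier (cat_algebra D)"
    "\<And>y x. \<lbrakk>y \<in> Obj D; x \<in> Obj D\<rbrakk> \<Longrightarrow> F (y, x) = L (y, x)"
  shows "F = L"
  by (rule extensionalityI[of _ "Obj D \<times> Obj D"]) (use assms in \<open>auto simp: cat_algebra_carrier\<close>)

lemma cat_algebra_apply:
  assumes "y \<in> Obj D" "x \<in> Obj D"
  shows "\<zero>\<^bsub>cat_algebra D\<^esub> (y, x) = \<zero>\<^bsub>Hom D y x\<^esub>"
    and "(F \<oplus>\<^bsub>cat_algebra D\<^esub> L) (y, x) = F (y, x) \<oplus>\<^bsub>Hom D y x\<^esub> L (y, x)"
    and "(c \<odot>\<^bsub>cat_algebra D\<^esub> F) (y, x) = c \<odot>\<^bsub>Hom D y x\<^esub> F (y, x)"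
    and "(F \<otimes>\<^bsub>cat_algebra D\<^esub> L) (y, x) =
      finsum (Hom D y x) (\<lambda>u. Comp D y u x (F (y, u)) (L (u, x))) (Obj D)"
  using assms by (simp_all add: cat_algebra_def direct_sum_simps)

lemma module_cat_algebra: "module K (cat_algebra D)"
  by (rule module_direct_sum[OF base_cring, of "Obj D \<times> Obj D" "\<lambda>(y, x). Hom D y x"])
    (auto simp: cat_algebra_def direct_sum_def Hom_module)

lemma cat_algebra_mult_closed:
  assumes "F \<in> carrier (cat_algebra D)" "L \<in> carrier (cat_algebra D)"
  shows "F \<otimes>\<^bsub>cat_algebra D\<^esub> L \<in> carrier (cat_algebra D)"
proof -
  have "F \<otimes>\<^bsub>cat_algebra D\<^esub> L \<in> extensional (Obj D \<times> Obj D)"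
    by (simp add: cat_algebra_def)
  then show ?thesis
    using assms by (auto simp: cat_algebra_carrier cat_algebra_apply
        intro!: abelian_monoid.finsum_closed[OF Hom_monoid] Comp_closed)
qed

end

locale finite_wnna_category = wnna_category +
  assumes finite_Obj: "finite (Obj D)"

sublocale finite_wnna_category \<subseteq> finite_module_graph K D
  by (intro finite_module_graph.intro base_cring finite_Obj Hom_module Comp_closed)

context finite_wnna_category
begin

text \<open>The zero morphism equals its own multiple by the scalar zero, and homogeneity of
  composition pulls that scalar out.\<close>

lemma Comp_zero_left:
  assumes "x \<in> Obj D" "y \<in> Obj D" "z \<in> Obj D" "l \<in> carrier (Hom D y x)"
  shows "Comp D z y x \<zero>\<^bsub>Hom D z y\<^esub> l = \<zero>\<^bsub>Hom D z x\<^esub>"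
proof -
  interpret A: module K "Hom D z y" using Hom_module assms by blast
  interpret B: module K "Hom D z x" using Hom_module assms by blast
  have "Comp D z y x (\<zero>\<^bsub>K\<^esub> \<odot>\<^bsub>Hom D z y\<^esub> \<zero>\<^bsub>Hom D z y\<^esub>) l = \<zero>\<^bsub>Hom D z x\<^esub>"
    using assms Comp_smult_left[of x y z "\<zero>\<^bsub>K\<^esub>" "\<zero>\<^bsub>Hom D z y\<^esub>" l] Comp_closed by simp
  then show ?thesis by (simp del: A.smult_l_null)
qed

lemma Comp_zero_right:
  assumes "x \<in> Obj D" "y \<in> Obj D" "z \<in> Obj D" "f \<in> carrier (Hom D z y)"
  shows "Comp D z y x f \<zero>\<^bsub>Hom D y x\<^esub> = \<zero>\<^bsub>Hom D z x\<^esub>"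
proof -
  interpret A: module K "Hom D y x" using Hom_module assms by blast
  interpret B: module K "Hom D z x" using Hom_module assms by blast
  have "Comp D z y x f (\<zero>\<^bsub>K\<^esub> \<odot>\<^bsub>Hom D y x\<^esub> \<zero>\<^bsub>Hom D y x\<^esub>) = \<zero>\<^bsub>Hom D z x\<^esub>"
    using assms Comp_smult_right[of x y z "\<zero>\<^bsub>K\<^esub>" f "\<zero>\<^bsub>Hom D y x\<^esub>"] Comp_closed by simp
  then show ?thesis by (simp del: A.smult_l_null)
qed

lemma nonassoc_algebra_cat_algebra: "nonassoc_algebra K (cat_algebra D)"
proof -
  let ?A = "cat_algebra D"
  interpret A: module K ?A by (rule module_cat_algebra)
  show ?thesis
  proof (intro nonassoc_algebra.intro A.module_axioms nonassoc_algebra_axioms.intro)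
    fix a a' b assume m: "a \<in> carrier ?A" "a' \<in> carrier ?A" "b \<in> carrier ?A"
    show "(a \<oplus>\<^bsub>?A\<^esub> a') \<otimes>\<^bsub>?A\<^esub> b = (a \<otimes>\<^bsub>?A\<^esub> b) \<oplus>\<^bsub>?A\<^esub> (a' \<otimes>\<^bsub>?A\<^esub> b)"
    proof (rule cat_algebra_eqI)
      fix y x assume o: "y \<in> Obj D" "x \<in> Obj D"
      interpret H: abelian_monoid "Hom D y x" using Hom_monoid o by blast
      show "((a \<oplus>\<^bsub>?A\<^esub> a') \<otimes>\<^bsub>?A\<^esub> b) (y, x) = ((a \<otimes>\<^bsub>?A\<^esub> b) \<oplus>\<^bsub>?A\<^esub> (a' \<otimes>\<^bsub>?A\<^esub> b)) (y, x)"
        using o m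
        by (auto simp: cat_algebra_apply Comp_add_left cat_algebra_entry
            intro!: H.finsum_addf[symmetric] Comp_closed H.finsum_cong' trans[OF _ H.finsum_addf]
              H.a_closed)
    qed (use m in \<open>auto intro!: cat_algebra_mult_closed\<close>)
  next
    fix a b b' assume m: "a \<in> carrier ?A" "b \<in> carrier ?A" "b' \<in> carrier ?A"
    show "a \<otimes>\<^bsub>?A\<^esub> (b \<oplus>\<^bsub>?A\<^esub> b') = (a \<otimes>\<^bsub>?A\<^esub> b) \<oplus>\<^bsub>?A\<^esub> (a \<otimes>\<^bsub>?A\<^esub> b')"
    proof (rule cat_algebra_eqI)
      fix y x assume o: "y \<in> Obj D" "x \<in> Obj D"
      interpret H: abelian_monoid "Hom D y x" using Hom_monoid o by blast
      show "(a \<otimes>\<^bsub>?A\<^esub> (b \<oplus>\<^bsub>?A\<^esub> b')) (y, x) = ((a \<otimes>\<^bsub>?A\<^esub> b) \<oplus>\<^bsub>?A\<^esub> (a \<otimes>\<^bsub>?A\<^esub> b')) (y, x)"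
        using o m
        by (auto simp: cat_algebra_apply Comp_add_right cat_algebra_entry
            intro!: H.finsum_addf[symmetric] Comp_closed H.finsum_cong' trans[OF _ H.finsum_addf]
              H.a_closed)
    qed (use m in \<open>auto intro!: cat_algebra_mult_closed\<close>)
  next
    fix c a b assume m: "c \<in> carrier K" "a \<in> carrier ?A" "b \<in> carrier ?A"
    show "(c \<odot>\<^bsub>?A\<^esub> a) \<otimes>\<^bsub>?A\<^esub> b = c \<odot>\<^bsub>?A\<^esub> (a \<otimes>\<^bsub>?A\<^esub> b)"
    proof (rule cat_algebra_eqI)
      fix y x assume o: "y \<in> Obj D" "x \<in> Obj D"
      interpret H: module K "Hom D y x" using Hom_module o by blast
      show "((c \<odot>\<^bsub>?A\<^esub> a) \<otimes>\<^bsub>?A\<^esub> b) (y, x) = (c \<odot>\<^bsub>?A\<^esub> (a \<otimes>\<^bsub>?A\<^esub> b)) (y, x)"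
        using o m finite_Obj
        by (auto simp: cat_algebra_apply Comp_smult_left cat_algebra_entry
            H.finsum_smult_ldistr Comp_closed
            intro!: H.M.finsum_cong')
    qed (use m in \<open>auto intro!: cat_algebra_mult_closed\<close>)
    show "a \<otimes>\<^bsub>?A\<^esub> (c \<odot>\<^bsub>?A\<^esub> b) = c \<odot>\<^bsub>?A\<^esub> (a \<otimes>\<^bsub>?A\<^esub> b)"
    proof (rule cat_algebra_eqI)
      fix y x assume o: "y \<in> Obj D" "x \<in> Obj D"
      interpret H: module K "Hom D y x" using Hom_module o by blast
      show "(a \<otimes>\<^bsub>?A\<^esub> (c \<odot>\<^bsub>?A\<^esub> b)) (y, x) = (c \<odot>\<^bsub>?A\<^esub> (a \<otimes>\<^bsub>?A\<^esub> b)) (y, x)"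
        using o m finite_Obj
        by (auto simp: cat_algebra_apply Comp_smult_right cat_algebra_entry
            H.finsum_smult_ldistr Comp_closed
            intro!: H.M.finsum_cong')
    qed (use m in \<open>auto intro!: cat_algebra_mult_closed\<close>)
  qed (rule cat_algebra_mult_closed)
qed

lemma Comp_finsum_left:
  assumes o: "x \<in> Obj D" "y \<in> Obj D" "z \<in> Obj D"
    and f: "\<And>i. i \<in> A \<Longrightarrow> f i \<in> carrier (Hom D z y)" and l: "l \<in> carrier (Hom D y x)"
  shows "Comp D z y x (finsum (Hom D z y) f A) l = finsum (Hom D z x) (\<lambda>i. Comp D z y x (f i) l) A"
  by (rule finsum_additive(2)[where H = "carrier (Hom D z y)" and h = "\<lambda>f. Comp D z y x f l"])
    (use assms in \<open>auto simp: Hom_monoid Comp_zero_left Comp_add_left Hom_zero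
      intro!: Comp_closed abelian_monoid.a_closed[OF Hom_monoid]\<close>)

lemma Comp_finsum_right:
  assumes o: "x \<in> Obj D" "y \<in> Obj D" "z \<in> Obj D"
    and f: "f \<in> carrier (Hom D z y)" and l: "\<And>i. i \<in> A \<Longrightarrow> l i \<in> carrier (Hom D y x)"
  shows "Comp D z y x f (finsum (Hom D y x) l A) = finsum (Hom D z x) (\<lambda>i. Comp D z y x f (l i)) A"
  by (rule finsum_additive(2)[where H = "carrier (Hom D y x)" and h = "Comp D z y x f"])
    (use assms in \<open>auto simp: Hom_monoid Comp_zero_right Comp_add_right Hom_zero
      intro!: Comp_closed abelian_monoid.a_closed[OF Hom_monoid]\<close>)

end

section \<open>Associativity and unit of the matrix algebra of a category\<close>

locale finite_k_category = k_category +
  assumes finite_Obj: "finite (Obj C)"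

sublocale finite_k_category \<subseteq> finite_wnna_category K C
  by unfold_locales (rule finite_Obj)

context finite_k_category
begin

text \<open>The diagonal of the unit matrix is a definite description. It is meaningful because two
  identities i and j of the same object satisfy i = ij = j.\<close>

lemma the_identity:
  assumes "x \<in> Obj C"
  shows "is_identity C x (THE i. is_identity C x i)"
proof -
  have "i = j" if "is_identity C x i" "is_identity C x j" for i j
  proof -
    have "Comp C x x x i j = i" "Comp C x x x i j = j"
      using that assms unfolding is_identity_def by blast+
    then show ?thesis by simp
  qed
  then show ?thesis using identities[OF assms] by (metis theI)
qed

lemma cat_algebra_one:
  assumes "y \<in> Obj C" "x \<in> Obj C"
  shows "\<one>\<^bsub>cat_algebra C\<^esub> (y, x) = (if y = x then (THE i. is_identity C x i) else \<zero>\<^bsub>Hom C y x\<^esub>)"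
  using assms by (simp add: cat_algebra_def)

lemma cat_algebra_one_closed: "\<one>\<^bsub>cat_algebra C\<^esub> \<in> carrier (cat_algebra C)"
proof -
  have "\<one>\<^bsub>cat_algebra C\<^esub> \<in> extensional (Obj C \<times> Obj C)" by (simp add: cat_algebra_def)
  then show ?thesis
    using the_identity[unfolded is_identity_def[of C _ "The _"]]
    by (simp add: cat_algebra_carrier cat_algebra_one Hom_zero)
qed

text \<open>Both bracketings expand, by bilinearity of composition, to a double sum over the two
  intermediate objects. Their terms agree by associativity in \<open>C\<close>, and only the order
  of summation differs.\<close>

lemma cat_algebra_mult_assoc:
  assumes F: "F \<in> carrier (cat_algebra C)" and L: "L \<in> carrier (cat_algebra C)"
    and N: "N \<in> carrier (cat_algebra C)"
  shows "F \<otimes>\<^bsub>cat_algebra C\<^esub> L \<otimes>\<^bsub>cat_algebra C\<^esub> N = F \<otimes>\<^bsub>cat_algebra C\<^esub> (L \<otimes>\<^bsub>cat_algebra C\<^esub> N)"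
proof (rule cat_algebra_eqI)
  fix z w assume o: "z \<in> Obj C" "w \<in> Obj C"
  interpret H: abelian_monoid "Hom C z w" using Hom_monoid o by blast
  note entries = F[THEN cat_algebra_entry] L[THEN cat_algebra_entry] N[THEN cat_algebra_entry]
  have "(F \<otimes>\<^bsub>cat_algebra C\<^esub> L \<otimes>\<^bsub>cat_algebra C\<^esub> N) (z, w) =
      finsum (Hom C z w) (\<lambda>x. finsum (Hom C z w)
        (\<lambda>y. Comp C z x w (Comp C z y x (F (z, y)) (L (y, x))) (N (x, w))) (Obj C)) (Obj C)"
    using o entries
    by (auto simp: cat_algebra_apply Comp_finsum_left Comp_closed
        intro!: H.finsum_cong' H.finsum_closed)
  also have "\<dots> = finsum (Hom C z w) (\<lambda>x. finsum (Hom C z w)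
        (\<lambda>y. Comp C z y w (F (z, y)) (Comp C y x w (L (y, x)) (N (x, w)))) (Obj C)) (Obj C)"
    using o entries
    by (intro H.finsum_cong') (auto simp: Comp_assoc intro!: Comp_closed H.finsum_closed H.finsum_cong')
  also have "\<dots> = finsum (Hom C z w) (\<lambda>y. finsum (Hom C z w)
        (\<lambda>x. Comp C z y w (F (z, y)) (Comp C y x w (L (y, x)) (N (x, w)))) (Obj C)) (Obj C)"
    using o entries by (intro H.finsum_commute) (auto intro!: Comp_closed)
  also have "\<dots> = (F \<otimes>\<^bsub>cat_algebra C\<^esub> (L \<otimes>\<^bsub>cat_algebra C\<^esub> N)) (z, w)"
    using o entries
    by (auto simp: cat_algebra_apply Comp_finsum_right Comp_closed
        intro!: H.finsum_cong' H.finsum_closed)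
  finally show "(F \<otimes>\<^bsub>cat_algebra C\<^esub> L \<otimes>\<^bsub>cat_algebra C\<^esub> N) (z, w) =
    (F \<otimes>\<^bsub>cat_algebra C\<^esub> (L \<otimes>\<^bsub>cat_algebra C\<^esub> N)) (z, w)" .
qed (use assms in \<open>auto intro!: cat_algebra_mult_closed\<close>)

text \<open>Off the diagonal the unit matrix is zero and composition with zero is zero, so one term
  of each sum survives.\<close>

lemma cat_algebra_one_mult:
  assumes F: "F \<in> carrier (cat_algebra C)"
  shows "\<one>\<^bsub>cat_algebra C\<^esub> \<otimes>\<^bsub>cat_algebra C\<^esub> F = F"
    and "F \<otimes>\<^bsub>cat_algebra C\<^esub> \<one>\<^bsub>cat_algebra C\<^esub> = F"
proof -
  have id: "Comp C y y x (THE i. is_identity C y i) (F (y, x)) = F (y, x)"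
    "Comp C y x x (F (y, x)) (THE i. is_identity C x i) = F (y, x)"
    if "y \<in> Obj C" "x \<in> Obj C" for y x
    using that the_identity cat_algebra_entry[OF F] unfolding is_identity_def by blast+
  show "\<one>\<^bsub>cat_algebra C\<^esub> \<otimes>\<^bsub>cat_algebra C\<^esub> F = F"
  proof (rule cat_algebra_eqI)
    fix y x assume o: "y \<in> Obj C" "x \<in> Obj C"
    interpret H: abelian_monoid "Hom C y x" using Hom_monoid o by blast
    have "(\<one>\<^bsub>cat_algebra C\<^esub> \<otimes>\<^bsub>cat_algebra C\<^esub> F) (y, x) =
        Comp C y y x (\<one>\<^bsub>cat_algebra C\<^esub> (y, y)) (F (y, x))"
      unfolding cat_algebra_apply(4)[OF o]
      using o F finite_Obj
      by (intro H.finsum_single_support)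
        (auto simp: cat_algebra_one id cat_algebra_entry Comp_zero_left)
    then show "(\<one>\<^bsub>cat_algebra C\<^esub> \<otimes>\<^bsub>cat_algebra C\<^esub> F) (y, x) = F (y, x)"
      using o by (simp add: cat_algebra_one id)
  qed (use F in \<open>auto intro!: cat_algebra_mult_closed cat_algebra_one_closed\<close>)
  show "F \<otimes>\<^bsub>cat_algebra C\<^esub> \<one>\<^bsub>cat_algebra C\<^esub> = F"
  proof (rule cat_algebra_eqI)
    fix y x assume o: "y \<in> Obj C" "x \<in> Obj C"
    interpret H: abelian_monoid "Hom C y x" using Hom_monoid o by blast
    have "(F \<otimes>\<^bsub>cat_algebra C\<^esub> \<one>\<^bsub>cat_algebra C\<^esub>) (y, x) =
        Comp C y x x (F (y, x)) (\<one>\<^bsub>cat_algebra C\<^esub> (x, x))"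
      unfolding cat_algebra_apply(4)[OF o]
      using o F finite_Obj
      by (intro H.finsum_single_support)
        (auto simp: cat_algebra_one id cat_algebra_entry Comp_zero_right)
    then show "(F \<otimes>\<^bsub>cat_algebra C\<^esub> \<one>\<^bsub>cat_algebra C\<^esub>) (y, x) = F (y, x)"
      using o by (simp add: cat_algebra_one id)
  qed (use F in \<open>auto intro!: cat_algebra_mult_closed cat_algebra_one_closed\<close>)
qed

lemma k_algebra_cat_algebra: "k_algebra K (cat_algebra C)"
proof -
  interpret A: nonassoc_algebra K "cat_algebra C" by (rule nonassoc_algebra_cat_algebra)
  have "ring (cat_algebra C)"
    by (intro ringI A.M.abelian_group_axioms monoidI)
      (auto intro: A.mult_closed cat_algebra_one_closed cat_algebra_mult_assoc
        cat_algebra_one_mult A.mult_add_left A.mult_add_right)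
  then show ?thesis by (simp add: k_algebra_def A.nonassoc_algebra_axioms)
qed

end

section \<open>The partial skew group algebra\<close>

text \<open>The bilinearity of the skew product depends only on a partial action on an algebra.
  Keeping \<open>R\<close> abstract separates it from the matrices, which enter when the locale is
  instantiated.\<close>

locale partial_algebra_action = group G
  for K :: "('k, 'c) ring_scheme" and G :: "('g, 'd) monoid_scheme" (structure)
    and R :: "('k, 'a, 'p) module_scheme" and S :: "'g \<Rightarrow> 'a set" and \<alpha> :: "'g \<Rightarrow> 'a \<Rightarrow> 'a" +
  assumes partial_action: "partial_action_algebra K G R S \<alpha>"

sublocale partial_algebra_action \<subseteq> R: nonassoc_algebra K R
  using partial_action by (simp add: partial_action_algebra_def k_algebra_def)

context partial_algebra_action
begin

lemma submodule_S: "g \<in> carrier G \<Longrightarrow> submodule (S g) K R"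
  using partial_action by (simp add: partial_action_algebra_def)

lemma module_S: "g \<in> carrier G \<Longrightarrow> module K (R\<lparr>carrier := S g\<rparr>)"
  using submodule.submodule_is_module[OF submodule_S] R.module_axioms by blast

lemma S_subset: "\<lbrakk>g \<in> carrier G; a \<in> S g\<rbrakk> \<Longrightarrow> a \<in> carrier R"
  using R.submoduleE(1)[OF submodule_S] by blast

lemma S_zero: "g \<in> carrier G \<Longrightarrow> \<zero>\<^bsub>R\<^esub> \<in> S g"
  using subgroup.one_closed[OF submodule.axioms(1)[OF submodule_S]] by simp

lemma S_add: "\<lbrakk>g \<in> carrier G; a \<in> S g; b \<in> S g\<rbrakk> \<Longrightarrow> a \<oplus>\<^bsub>R\<^esub> b \<in> S g"
  using R.submoduleE(5)[OF submodule_S] by blast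

lemma S_ideal:
  assumes "g \<in> carrier G" "a \<in> S g" "r \<in> carrier R"
  shows "a \<otimes>\<^bsub>R\<^esub> r \<in> S g" "r \<otimes>\<^bsub>R\<^esub> a \<in> S g"
proof -
  have "ideal (S g) R" using partial_action assms by (simp add: partial_action_algebra_def)
  then show "a \<otimes>\<^bsub>R\<^esub> r \<in> S g" "r \<otimes>\<^bsub>R\<^esub> a \<in> S g"
    using assms by (auto dest: ideal.I_r_closed ideal.I_l_closed)
qed

lemma \<alpha>_iso: "g \<in> carrier G \<Longrightarrow> module_iso K (R\<lparr>carrier := S (inv g)\<rparr>) (R\<lparr>carrier := S g\<rparr>) (\<alpha> g)"
  using partial_action by (simp add: partial_action_algebra_def algebra_iso_def)

lemma \<alpha>_closed: "\<lbrakk>g \<in> carrier G; a \<in> S (inv g)\<rbrakk> \<Longrightarrow> \<alpha> g a \<in> S g"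
  using \<alpha>_iso by (force simp: module_iso_def bij_betw_def)

lemma \<alpha>_inv_closed: "\<lbrakk>g \<in> carrier G; a \<in> S g\<rbrakk> \<Longrightarrow> \<alpha> (inv g) a \<in> S (inv g)"
  using \<alpha>_closed[of "inv g"] by simp

lemma \<alpha>_add:
  "\<lbrakk>g \<in> carrier G; a \<in> S (inv g); b \<in> S (inv g)\<rbrakk> \<Longrightarrow> \<alpha> g (a \<oplus>\<^bsub>R\<^esub> b) = \<alpha> g a \<oplus>\<^bsub>R\<^esub> \<alpha> g b"
  using \<alpha>_iso by (simp add: module_iso_def)

lemma \<alpha>_smult:
  "\<lbrakk>g \<in> carrier G; c \<in> carrier K; a \<in> S (inv g)\<rbrakk> \<Longrightarrow> \<alpha> g (c \<odot>\<^bsub>R\<^esub> a) = c \<odot>\<^bsub>R\<^esub> \<alpha> g a"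
  using \<alpha>_iso by (simp add: module_iso_def)

text \<open>The axiom constrains preimages. Applied to the pair \<open>inv h\<close>,
  \<open>inv g\<close> at the point \<open>\<alpha> g c\<close>, whose image under
  \<open>\<alpha> (inv g)\<close> is \<open>c\<close> again, it becomes this statement about images.
  It is the reason why coefficients of a product land in the correct ideal.\<close>

lemma \<alpha>_inter:
  assumes "g \<in> carrier G" "h \<in> carrier G" "c \<in> S (inv g)" "c \<in> S h"
  shows "\<alpha> g c \<in> S (g \<otimes> h)"
proof -
  have P: "partial_action_set G (carrier R) S \<alpha>"
    using partial_action by (simp add: partial_action_algebra_def)
  have comp: "x \<in> S (inv (g' \<otimes> h')) \<and> \<alpha> g' (\<alpha> h' x) = \<alpha> (g' \<otimes> h') x"
    if "g' \<in> carrier G" "h' \<in> carrier G" "x \<in> S (inv h')" "\<alpha> h' x \<in> S h'" "\<alpha> h' x \<in> S (inv g')"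
    for g' h' x
    using P that unfolding partial_action_set_def by blast
  have "\<alpha> (inv g) (\<alpha> g c) = \<alpha> (inv g \<otimes> g) c"
    using comp[of "inv g" g c] assms \<alpha>_closed by simp
  also have "\<dots> = c"
    using P assms S_subset by (simp add: partial_action_set_def)
  finally have "\<alpha> (inv g) (\<alpha> g c) = c" .
  then have "\<alpha> g c \<in> S (inv (inv h \<otimes> inv g))"
    using comp[of "inv h" "inv g" "\<alpha> g c"] assms \<alpha>_closed by simp
  then show ?thesis using assms by (simp add: inv_mult_group)
qed

text \<open>The coefficient of the product of a u_g and b u_h. It depends on h only through the
  ideal in which b lies.\<close>

definition skew_term :: "'g \<Rightarrow> 'a \<Rightarrow> 'a \<Rightarrow> 'a"
  where "skew_term g a b = \<alpha> g (\<alpha> (inv g) a \<otimes>\<^bsub>R\<^esub> b)"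

text \<open>The product inside \<alpha> lies in \<open>S (inv g)\<close> because of its left factor
  and in \<open>S h\<close> because of its right factor, both being ideals. Hence
  \<open>\<alpha>_inter\<close> applies.\<close>

lemma skew_term_closed:
  assumes "g \<in> carrier G" "h \<in> carrier G" "a \<in> S g" "b \<in> S h"
  shows "skew_term g a b \<in> S (g \<otimes> h)"
  unfolding skew_term_def using assms
  by (intro \<alpha>_inter S_ideal) (auto intro: \<alpha>_inv_closed S_subset S_subset[of "inv g"])

text \<open>\<open>\<alpha> g\<close> is additive only on \<open>S (inv g)\<close>. Both summands
  lie there, as this ideal contains \<open>\<alpha> (inv g) a\<close> and
  \<open>\<alpha> (inv g) a'\<close>. The three rules that follow rest on the same remark.\<close>

lemma skew_term_add_left:
  assumes "g \<in> carrier G" "a \<in> S g" "a' \<in> S g" "b \<in> carrier R"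
  shows "skew_term g (a \<oplus>\<^bsub>R\<^esub> a') b = skew_term g a b \<oplus>\<^bsub>R\<^esub> skew_term g a' b"
proof -
  have *: "\<alpha> (inv g) a \<in> S (inv g)" "\<alpha> (inv g) a' \<in> S (inv g)"
    using assms \<alpha>_inv_closed by auto
  then have "\<alpha> (inv g) a \<in> carrier R" "\<alpha> (inv g) a' \<in> carrier R"
    using assms S_subset[of "inv g"] by auto
  then show ?thesis
    using * assms by (simp add: skew_term_def \<alpha>_add R.mult_add_left S_ideal)
qed

lemma skew_term_add_right:
  assumes "g \<in> carrier G" "a \<in> S g" "b \<in> carrier R" "b' \<in> carrier R"
  shows "skew_term g a (b \<oplus>\<^bsub>R\<^esub> b') = skew_term g a b \<oplus>\<^bsub>R\<^esub> skew_term g a b'"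
proof -
  have *: "\<alpha> (inv g) a \<in> S (inv g)"
    using assms \<alpha>_inv_closed by auto
  then have "\<alpha> (inv g) a \<in> carrier R"
    using assms S_subset[of "inv g"] by auto
  then show ?thesis
    using * assms by (simp add: skew_term_def \<alpha>_add R.mult_add_right S_ideal)
qed

lemma skew_term_smult_left:
  assumes "g \<in> carrier G" "c \<in> carrier K" "a \<in> S g" "b \<in> carrier R"
  shows "skew_term g (c \<odot>\<^bsub>R\<^esub> a) b = c \<odot>\<^bsub>R\<^esub> skew_term g a b"
proof -
  have *: "\<alpha> (inv g) a \<in> S (inv g)"
    using assms \<alpha>_inv_closed by auto
  then have "\<alpha> (inv g) a \<in> carrier R"
    using assms S_subset[of "inv g"] by auto
  then show ?thesis
    using * assms by (simp add: skew_term_def \<alpha>_smult R.mult_smult_left S_ideal)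
qed

lemma skew_term_smult_right:
  assumes "g \<in> carrier G" "c \<in> carrier K" "a \<in> S g" "b \<in> carrier R"
  shows "skew_term g a (c \<odot>\<^bsub>R\<^esub> b) = c \<odot>\<^bsub>R\<^esub> skew_term g a b"
proof -
  have *: "\<alpha> (inv g) a \<in> S (inv g)"
    using assms \<alpha>_inv_closed by auto
  then have "\<alpha> (inv g) a \<in> carrier R"
    using assms S_subset[of "inv g"] by auto
  then show ?thesis
    using * assms by (simp add: skew_term_def \<alpha>_smult R.mult_smult_right S_ideal)
qed

lemma skew_term_zero:
  "\<lbrakk>g \<in> carrier G; b \<in> carrier R\<rbrakk> \<Longrightarrow> skew_term g \<zero>\<^bsub>R\<^esub> b = \<zero>\<^bsub>R\<^esub>"
  "\<lbrakk>g \<in> carrier G; a \<in> S g\<rbrakk> \<Longrightarrow> skew_term g a \<zero>\<^bsub>R\<^esub> = \<zero>\<^bsub>R\<^esub>"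
  \<comment> \<open>Again zero is a multiple of itself by the scalar zero. Closure is invoked with
    the group element \<open>\<one>\<close> for the right factor, since \<open>S \<one>\<close> is
    the whole of \<open>R\<close> and so imposes no condition on it.\<close>
  using skew_term_smult_left[of g "\<zero>\<^bsub>K\<^esub>" "\<zero>\<^bsub>R\<^esub>" b] skew_term_smult_right[of g "\<zero>\<^bsub>K\<^esub>" a "\<zero>\<^bsub>R\<^esub>"]
    skew_term_closed[of g \<one> "\<zero>\<^bsub>R\<^esub>" b] skew_term_closed[of g \<one> a "\<zero>\<^bsub>R\<^esub>"] S_zero[of g] S_zero[of \<one>]
    partial_action S_subset[of g]
  by (simp_all add: partial_action_algebra_def partial_action_set_def)

section \<open>Formal sums, their supports and their products\<close>

abbreviation "skew \<equiv> partial_skew_group_algebra G R S \<alpha>"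

lemma skew_carrier:
  "a \<in> carrier skew \<longleftrightarrow> a \<in> (\<Pi>\<^sub>E g\<in>carrier G. S g) \<and> finite {g \<in> carrier G. a g \<noteq> \<zero>\<^bsub>R\<^esub>}"
  by (simp add: partial_skew_group_algebra_def direct_sum_simps)

lemma skew_entry: "\<lbrakk>a \<in> carrier skew; g \<in> carrier G\<rbrakk> \<Longrightarrow> a g \<in> S g"
  by (auto simp: skew_carrier)

lemma skew_eqI:
  assumes "a \<in> carrier skew" "b \<in> carrier skew" "\<And>g. g \<in> carrier G \<Longrightarrow> a g = b g"
  shows "a = b"
  by (rule extensionalityI[of _ "carrier G"]) (use assms in \<open>auto simp: skew_carrier PiE_iff\<close>)

lemma skew_apply:
  assumes "g \<in> carrier G"
  shows "\<zero>\<^bsub>skew\<^esub> g = \<zero>\<^bsub>R\<^esub>"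
    and "(a \<oplus>\<^bsub>skew\<^esub> b) g = a g \<oplus>\<^bsub>R\<^esub> b g"
    and "(c \<odot>\<^bsub>skew\<^esub> a) g = c \<odot>\<^bsub>R\<^esub> a g"
  using assms by (simp_all add: partial_skew_group_algebra_def direct_sum_simps)

lemma module_skew: "module K skew"
  by (rule module_direct_sum[OF R.R.cring_axioms, of "carrier G" "\<lambda>g. R\<lparr>carrier := S g\<rparr>"])
    (simp_all add: module_S partial_skew_group_algebra_def direct_sum_def)

definition support :: "('g \<Rightarrow> 'a) \<Rightarrow> 'g set"
  where "support a = {g \<in> carrier G. a g \<noteq> \<zero>\<^bsub>R\<^esub>}"

lemma finite_support: "a \<in> carrier skew \<Longrightarrow> finite (support a)"
  by (simp add: skew_carrier support_def)

lemma support_subset: "support a \<subseteq> carrier G"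
  by (auto simp: support_def)

lemma in_support: "g \<in> support a \<Longrightarrow> g \<in> carrier G"
  by (simp add: support_def)

lemma skew_entry_R: "\<lbrakk>a \<in> carrier skew; g \<in> carrier G\<rbrakk> \<Longrightarrow> a g \<in> carrier R"
  using skew_entry S_subset by blast

lemma skew_term_entry_R:
  "\<lbrakk>a \<in> carrier skew; b \<in> carrier skew; g \<in> carrier G; h \<in> carrier G\<rbrakk>
    \<Longrightarrow> skew_term g (a g) (b h) \<in> carrier R"
  using skew_term_closed[of g h "a g" "b h"] skew_entry S_subset[of "g \<otimes> h"] by simp

text \<open>The defining sum runs over the exact supports, which change when factors are added or
  scaled. A pair outside them contributes zero, so any finite sets containing the supports may be
  used, and different products can be compared over the same index set.\<close>

lemma skew_mult_apply:
  assumes a: "a \<in> carrier skew" and b: "b \<in> carrier skew" and s: "s \<in> carrier G"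
    and A: "finite A" "A \<subseteq> carrier G" "support a \<subseteq> A"
    and B: "finite B" "B \<subseteq> carrier G" "support b \<subseteq> B"
  shows "(a \<otimes>\<^bsub>skew\<^esub> b) s = finsum R (\<lambda>(g, h). skew_term g (a g) (b h)) {(g, h) \<in> A \<times> B. g \<otimes> h = s}"
proof -
  let ?P = "{(g, h). g \<in> carrier G \<and> h \<in> carrier G \<and> a g \<noteq> \<zero>\<^bsub>R\<^esub> \<and> b h \<noteq> \<zero>\<^bsub>R\<^esub> \<and> g \<otimes> h = s}"
  let ?Q = "{(g, h) \<in> A \<times> B. g \<otimes> h = s}"
  have "(a \<otimes>\<^bsub>skew\<^esub> b) s = finsum R (\<lambda>(g, h). skew_term g (a g) (b h)) ?P"
    using s by (simp add: partial_skew_group_algebra_def skew_term_def)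
  also have "\<dots> = finsum R (\<lambda>(g, h). skew_term g (a g) (b h)) ?Q"
  proof (rule R.M.finsum_mono_neutral)
    show "finite ?Q"
      by (rule finite_subset[of _ "A \<times> B"]) (use A B in auto)
    show "?P \<subseteq> ?Q"
      using A(3) B(3) by (auto simp: support_def)
    fix p assume "p \<in> ?Q - ?P"
    then obtain g h where p: "p = (g, h)" "g \<in> carrier G" "h \<in> carrier G" "a g = \<zero>\<^bsub>R\<^esub> \<or> b h = \<zero>\<^bsub>R\<^esub>"
      using A(2) B(2) by auto
    from p(4) have "skew_term g (a g) (b h) = \<zero>\<^bsub>R\<^esub>"
      using skew_term_zero(1)[OF p(2) skew_entry_R[OF b p(3)]]
        skew_term_zero(2)[OF p(2) skew_entry[OF a p(2)]] by (elim disjE) simp_all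
    then show "(case p of (g, h) \<Rightarrow> skew_term g (a g) (b h)) = \<zero>\<^bsub>R\<^esub>"
      using p(1) by simp
  next
    fix p assume "p \<in> ?P"
    then show "(case p of (g, h) \<Rightarrow> skew_term g (a g) (b h)) \<in> carrier R"
      using a b skew_term_entry_R by auto
  qed
  finally show ?thesis .
qed

lemma skew_mult_closed:
  assumes a: "a \<in> carrier skew" and b: "b \<in> carrier skew"
  shows "a \<otimes>\<^bsub>skew\<^esub> b \<in> carrier skew"
proof -
  have eq: "(a \<otimes>\<^bsub>skew\<^esub> b) s = finsum R (\<lambda>(g, h). skew_term g (a g) (b h))
      {(g, h) \<in> support a \<times> support b. g \<otimes> h = s}"
    if "s \<in> carrier G" for s
    using a b that by (intro skew_mult_apply finite_support support_subset order_refl)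
  have "(a \<otimes>\<^bsub>skew\<^esub> b) s \<in> S s" if s: "s \<in> carrier G" for s
    unfolding eq[OF s]
  \<comment> \<open>With the identity as the additive map, this is closure of the ideal
    \<open>S s\<close> under finite sums.\<close>
  proof (rule finsum_additive(1)[where h = "\<lambda>x. x" and N = R])
    fix p assume "p \<in> {(g, h) \<in> support a \<times> support b. g \<otimes> h = s}"
    then show "(case p of (g, h) \<Rightarrow> skew_term g (a g) (b h)) \<in> S s"
      by (auto intro!: skew_term_closed skew_entry[OF a] skew_entry[OF b] dest: in_support)
  qed (use s in \<open>auto simp: R.M.abelian_monoid_axioms S_subset S_zero S_add\<close>)
  moreover have "(a \<otimes>\<^bsub>skew\<^esub> b) \<in> extensional (carrier G)"
    by (simp add: partial_skew_group_algebra_def)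
  \<comment> \<open>If \<open>s\<close> is not a product of elements of the two supports, its
    coefficient is an empty sum.\<close>
  moreover have "finite {s \<in> carrier G. (a \<otimes>\<^bsub>skew\<^esub> b) s \<noteq> \<zero>\<^bsub>R\<^esub>}"
  proof (rule finite_subset)
    show "{s \<in> carrier G. (a \<otimes>\<^bsub>skew\<^esub> b) s \<noteq> \<zero>\<^bsub>R\<^esub>} \<subseteq> (\<lambda>(g, h). g \<otimes> h) ` (support a \<times> support b)"
    proof
      fix s assume "s \<in> {s \<in> carrier G. (a \<otimes>\<^bsub>skew\<^esub> b) s \<noteq> \<zero>\<^bsub>R\<^esub>}"
      then have s: "s \<in> carrier G" "(a \<otimes>\<^bsub>skew\<^esub> b) s \<noteq> \<zero>\<^bsub>R\<^esub>" by auto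
      have "{(g, h) \<in> support a \<times> support b. g \<otimes> h = s} \<noteq> {}"
      proof
        assume empty: "{(g, h) \<in> support a \<times> support b. g \<otimes> h = s} = {}"
        show False using s(2) unfolding eq[OF s(1)] empty by (simp add: R.M.finsum_empty)
      qed
      then show "s \<in> (\<lambda>(g, h). g \<otimes> h) ` (support a \<times> support b)" by force
    qed
  qed (use a b finite_support in auto)
  ultimately show ?thesis by (simp add: skew_carrier PiE_iff)
qed

lemma nonassoc_algebra_skew: "nonassoc_algebra K skew"
proof -
  interpret A: module K skew by (rule module_skew)
  show ?thesis
  proof (intro nonassoc_algebra.intro A.module_axioms nonassoc_algebra_axioms.intro)
    fix a a' b assume m: "a \<in> carrier skew" "a' \<in> carrier skew" "b \<in> carrier skew"
    show "(a \<oplus>\<^bsub>skew\<^esub> a') \<otimes>\<^bsub>skew\<^esub> b = (a \<otimes>\<^bsub>skew\<^esub> b) \<oplus>\<^bsub>skew\<^esub> (a' \<otimes>\<^bsub>skew\<^esub> b)"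
    proof (rule skew_eqI)
      fix s assume s: "s \<in> carrier G"
      \<comment> \<open>The supports of \<open>a\<close>, \<open>a'\<close> and their sum all lie in
        the union, so the three products become sums over this one set.\<close>
      let ?T = "{(g, h) \<in> (support a \<union> support a') \<times> support b. g \<otimes> h = s}"
      have eq: "(c \<otimes>\<^bsub>skew\<^esub> b) s = finsum R (\<lambda>(g, h). skew_term g (c g) (b h)) ?T"
        if "c \<in> carrier skew" "support c \<subseteq> support a \<union> support a'" for c
        using that m s by (intro skew_mult_apply) (auto simp: finite_support dest!: in_support)
      have "support (a \<oplus>\<^bsub>skew\<^esub> a') \<subseteq> support a \<union> support a'"
        by (auto simp: skew_apply support_def)
      then have "((a \<oplus>\<^bsub>skew\<^esub> a') \<otimes>\<^bsub>skew\<^esub> b) s =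
          finsum R (\<lambda>(g, h). skew_term g ((a \<oplus>\<^bsub>skew\<^esub> a') g) (b h)) ?T"
        using m by (intro eq) auto
      also have "\<dots> = finsum R (\<lambda>p. (case p of (g, h) \<Rightarrow> skew_term g (a g) (b h)) \<oplus>\<^bsub>R\<^esub>
          (case p of (g, h) \<Rightarrow> skew_term g (a' g) (b h))) ?T"
        by (intro R.M.finsum_cong')
          (use m in \<open>auto simp: skew_apply skew_term_add_left skew_entry skew_entry_R skew_term_entry_R
            dest!: in_support\<close>)
      also have "\<dots> = (a \<otimes>\<^bsub>skew\<^esub> b) s \<oplus>\<^bsub>R\<^esub> (a' \<otimes>\<^bsub>skew\<^esub> b) s"
        using m by (subst R.M.finsum_addf) (auto simp: eq skew_term_entry_R dest!: in_support)
      finally show "((a \<oplus>\<^bsub>skew\<^esub> a') \<otimes>\<^bsub>skew\<^esub> b) s = ((a \<otimes>\<^bsub>skew\<^esub> b) \<oplus>\<^bsub>skew\<^esub> (a' \<otimes>\<^bsub>skew\<^esub> b)) s"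
        using s by (simp add: skew_apply)
    qed (use m in \<open>auto intro!: skew_mult_closed\<close>)
  next
    fix a b b' assume m: "a \<in> carrier skew" "b \<in> carrier skew" "b' \<in> carrier skew"
    show "a \<otimes>\<^bsub>skew\<^esub> (b \<oplus>\<^bsub>skew\<^esub> b') = (a \<otimes>\<^bsub>skew\<^esub> b) \<oplus>\<^bsub>skew\<^esub> (a \<otimes>\<^bsub>skew\<^esub> b')"
    proof (rule skew_eqI)
      fix s assume s: "s \<in> carrier G"
      let ?T = "{(g, h) \<in> support a \<times> (support b \<union> support b'). g \<otimes> h = s}"
      have eq: "(a \<otimes>\<^bsub>skew\<^esub> c) s = finsum R (\<lambda>(g, h). skew_term g (a g) (c h)) ?T"
        if "c \<in> carrier skew" "support c \<subseteq> support b \<union> support b'" for c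
        using that m s by (intro skew_mult_apply) (auto simp: finite_support dest!: in_support)
      have "support (b \<oplus>\<^bsub>skew\<^esub> b') \<subseteq> support b \<union> support b'"
        by (auto simp: skew_apply support_def)
      then have "(a \<otimes>\<^bsub>skew\<^esub> (b \<oplus>\<^bsub>skew\<^esub> b')) s =
          finsum R (\<lambda>(g, h). skew_term g (a g) ((b \<oplus>\<^bsub>skew\<^esub> b') h)) ?T"
        using m by (intro eq) auto
      also have "\<dots> = finsum R (\<lambda>p. (case p of (g, h) \<Rightarrow> skew_term g (a g) (b h)) \<oplus>\<^bsub>R\<^esub>
          (case p of (g, h) \<Rightarrow> skew_term g (a g) (b' h))) ?T"
        by (intro R.M.finsum_cong')
          (use m in \<open>auto simp: skew_apply skew_term_add_right skew_entry skew_entry_R skew_term_entry_R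
            dest!: in_support\<close>)
      also have "\<dots> = (a \<otimes>\<^bsub>skew\<^esub> b) s \<oplus>\<^bsub>R\<^esub> (a \<otimes>\<^bsub>skew\<^esub> b') s"
        using m by (subst R.M.finsum_addf) (auto simp: eq skew_term_entry_R dest!: in_support)
      finally show "(a \<otimes>\<^bsub>skew\<^esub> (b \<oplus>\<^bsub>skew\<^esub> b')) s = ((a \<otimes>\<^bsub>skew\<^esub> b) \<oplus>\<^bsub>skew\<^esub> (a \<otimes>\<^bsub>skew\<^esub> b')) s"
        using s by (simp add: skew_apply)
    qed (use m in \<open>auto intro!: skew_mult_closed\<close>)
  next
    fix c a b assume m: "c \<in> carrier K" "a \<in> carrier skew" "b \<in> carrier skew"
    have fin': "finite {(g, h) \<in> support a \<times> support b. g \<otimes> h = s}" for s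
      by (rule finite_subset[of _ "support a \<times> support b"]) (use m finite_support in auto)
    have eq: "(a' \<otimes>\<^bsub>skew\<^esub> b') s =
        finsum R (\<lambda>(g, h). skew_term g (a' g) (b' h)) {(g, h) \<in> support a \<times> support b. g \<otimes> h = s}"
      if "a' \<in> carrier skew" "support a' \<subseteq> support a" "b' \<in> carrier skew" "support b' \<subseteq> support b"
        "s \<in> carrier G" for a' b' s
      using that m by (intro skew_mult_apply) (auto simp: finite_support dest!: in_support)
    \<comment> \<open>Scaling can only shrink a support, so the index set of the unscaled product
      serves for both homogeneity laws.\<close>
    have supp: "support (c \<odot>\<^bsub>skew\<^esub> d) \<subseteq> support d" for d
      using m by (auto simp: skew_apply support_def)
    show "(c \<odot>\<^bsub>skew\<^esub> a) \<otimes>\<^bsub>skew\<^esub> b = c \<odot>\<^bsub>skew\<^esub> (a \<otimes>\<^bsub>skew\<^esub> b)"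
    proof (rule skew_eqI)
      fix s assume s: "s \<in> carrier G"
      have "((c \<odot>\<^bsub>skew\<^esub> a) \<otimes>\<^bsub>skew\<^esub> b) s = finsum R (\<lambda>(g, h). skew_term g ((c \<odot>\<^bsub>skew\<^esub> a) g) (b h))
          {(g, h) \<in> support a \<times> support b. g \<otimes> h = s}"
        using m s by (intro eq supp) auto
      also have "\<dots> = finsum R (\<lambda>p. c \<odot>\<^bsub>R\<^esub> (case p of (g, h) \<Rightarrow> skew_term g (a g) (b h)))
          {(g, h) \<in> support a \<times> support b. g \<otimes> h = s}"
        by (intro R.M.finsum_cong')
          (use m in \<open>auto simp: skew_apply skew_term_smult_left skew_entry skew_entry_R skew_term_entry_R
            dest!: in_support\<close>)
      also have "\<dots> = c \<odot>\<^bsub>R\<^esub> finsum R (\<lambda>(g, h). skew_term g (a g) (b h))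
          {(g, h) \<in> support a \<times> support b. g \<otimes> h = s}"
        by (intro R.finsum_smult_ldistr[symmetric] fin')
          (use m in \<open>auto simp: skew_term_entry_R dest!: in_support\<close>)
      also have "\<dots> = c \<odot>\<^bsub>R\<^esub> (a \<otimes>\<^bsub>skew\<^esub> b) s"
        using m s by (subst eq) auto
      finally show "((c \<odot>\<^bsub>skew\<^esub> a) \<otimes>\<^bsub>skew\<^esub> b) s = (c \<odot>\<^bsub>skew\<^esub> (a \<otimes>\<^bsub>skew\<^esub> b)) s"
        using s by (simp add: skew_apply)
    qed (use m in \<open>auto intro!: skew_mult_closed\<close>)
    show "a \<otimes>\<^bsub>skew\<^esub> (c \<odot>\<^bsub>skew\<^esub> b) = c \<odot>\<^bsub>skew\<^esub> (a \<otimes>\<^bsub>skew\<^esub> b)"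
    proof (rule skew_eqI)
      fix s assume s: "s \<in> carrier G"
      have "(a \<otimes>\<^bsub>skew\<^esub> (c \<odot>\<^bsub>skew\<^esub> b)) s = finsum R (\<lambda>(g, h). skew_term g (a g) ((c \<odot>\<^bsub>skew\<^esub> b) h))
          {(g, h) \<in> support a \<times> support b. g \<otimes> h = s}"
        using m s by (intro eq supp) auto
      also have "\<dots> = finsum R (\<lambda>p. c \<odot>\<^bsub>R\<^esub> (case p of (g, h) \<Rightarrow> skew_term g (a g) (b h)))
          {(g, h) \<in> support a \<times> support b. g \<otimes> h = s}"
        by (intro R.M.finsum_cong')
          (use m in \<open>auto simp: skew_apply skew_term_smult_right skew_entry skew_entry_R skew_term_entry_R
            dest!: in_support\<close>)
      also have "\<dots> = c \<odot>\<^bsub>R\<^esub> finsum R (\<lambda>(g, h). skew_term g (a g) (b h))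
          {(g, h) \<in> support a \<times> support b. g \<otimes> h = s}"
        by (intro R.finsum_smult_ldistr[symmetric] fin')
          (use m in \<open>auto simp: skew_term_entry_R dest!: in_support\<close>)
      also have "\<dots> = c \<odot>\<^bsub>R\<^esub> (a \<otimes>\<^bsub>skew\<^esub> b) s"
        using m s by (subst eq) auto
      finally show "(a \<otimes>\<^bsub>skew\<^esub> (c \<odot>\<^bsub>skew\<^esub> b)) s = (c \<odot>\<^bsub>skew\<^esub> (a \<otimes>\<^bsub>skew\<^esub> b)) s"
        using s by (simp add: skew_apply)
    qed (use m in \<open>auto intro!: skew_mult_closed\<close>)
  qed (rule skew_mult_closed)
qed

end

section \<open>The induced partial action\<close>

locale finite_partial_action = partial_action_category K G C \<alpha>
  for K :: "('k, 'c) ring_scheme" and G :: "('g, 'd) monoid_scheme" (structure)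
    and C :: "('o, 'k, 'm) wnna_cat" and \<alpha> :: "('g, 'o, 'm) partial_action_data" +
  assumes finite_Obj: "finite (Obj C)"

sublocale finite_partial_action \<subseteq> finite_k_category K C
  by unfold_locales (rule finite_Obj)

context finite_partial_action
begin

section \<open>Pointwise consequences of the axioms of a partial action on a category\<close>

lemma Dom_Obj: "\<lbrakk>g \<in> carrier G; x \<in> Dom \<alpha> g\<rbrakk> \<Longrightarrow> x \<in> Obj C"
  using objects by (auto simp: partial_action_set_def)

lemma act_closed: "\<lbrakk>g \<in> carrier G; x \<in> Dom \<alpha> (inv g)\<rbrakk> \<Longrightarrow> act \<alpha> g x \<in> Dom \<alpha> g"
  using objects by (force simp: partial_action_set_def bij_betw_def)

lemma act_inv_closed: "\<lbrakk>g \<in> carrier G; x \<in> Dom \<alpha> g\<rbrakk> \<Longrightarrow> act \<alpha> (inv g) x \<in> Dom \<alpha> (inv g)"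
  using act_closed[of "inv g" x] by simp

lemma act_act:
  assumes "g \<in> carrier G" "h \<in> carrier G" "x \<in> Dom \<alpha> (inv h)" "act \<alpha> h x \<in> Dom \<alpha> (inv g)"
  shows "x \<in> Dom \<alpha> (inv (g \<otimes> h))" "act \<alpha> g (act \<alpha> h x) = act \<alpha> (g \<otimes> h) x"
  using objects assms act_closed[of h x] by (auto simp: partial_action_set_def)

lemma act_one: "x \<in> Obj C \<Longrightarrow> act \<alpha> \<one> x = x"
  using objects by (simp add: partial_action_set_def)

lemma Dom_one: "Dom \<alpha> \<one> = Obj C"
  using objects by (simp add: partial_action_set_def)

lemma act_inv_act: "\<lbrakk>g \<in> carrier G; x \<in> Dom \<alpha> (inv g)\<rbrakk> \<Longrightarrow> act \<alpha> (inv g) (act \<alpha> g x) = x"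
  using act_act(2)[of "inv g" g x] act_closed[of g x] act_one Dom_Obj[of "inv g" x] by simp

lemma act_act_inv: "\<lbrakk>g \<in> carrier G; x \<in> Dom \<alpha> g\<rbrakk> \<Longrightarrow> act \<alpha> g (act \<alpha> (inv g) x) = x"
  using act_inv_act[of "inv g" x] by simp

text \<open>The entries of an induced map are indexed by target positions, so composing two such
  maps means going back along \<open>inv g\<close> first and \<open>inv h\<close> second.\<close>

lemma act_inv_act_inv:
  assumes "g \<in> carrier G" "h \<in> carrier G" "v \<in> Dom \<alpha> g" "act \<alpha> (inv g) v \<in> Dom \<alpha> h"
  shows "v \<in> Dom \<alpha> (g \<otimes> h)" "act \<alpha> (inv h) (act \<alpha> (inv g) v) = act \<alpha> (inv (g \<otimes> h)) v"
  using act_act[of "inv h" "inv g" v] assms by (simp_all add: inv_mult_group)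

lemma submodule_Ideal_at:
  "\<lbrakk>g \<in> carrier G; y \<in> Obj C; x \<in> Obj C\<rbrakk> \<Longrightarrow> submodule (Ideal_at \<alpha> g y x) K (Hom C y x)"
  using ideals by (simp add: category_ideal_def)

lemma Ideal_at_module:
  "\<lbrakk>g \<in> carrier G; y \<in> Obj C; x \<in> Obj C\<rbrakk> \<Longrightarrow> module K ((Hom C y x)\<lparr>carrier := Ideal_at \<alpha> g y x\<rparr>)"
  using submodule.submodule_is_module[OF submodule_Ideal_at] Hom_module by blast

lemma Ideal_at_Hom:
  "\<lbrakk>g \<in> carrier G; y \<in> Obj C; x \<in> Obj C; f \<in> Ideal_at \<alpha> g y x\<rbrakk> \<Longrightarrow> f \<in> carrier (Hom C y x)"
  using module.submoduleE(1)[OF Hom_module submodule_Ideal_at] by blast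

lemma Ideal_at_closed:
  assumes "g \<in> carrier G" "y \<in> Obj C" "x \<in> Obj C"
  shows "\<zero>\<^bsub>Hom C y x\<^esub> \<in> Ideal_at \<alpha> g y x"
    and "\<lbrakk>f \<in> Ideal_at \<alpha> g y x; l \<in> Ideal_at \<alpha> g y x\<rbrakk> \<Longrightarrow> f \<oplus>\<^bsub>Hom C y x\<^esub> l \<in> Ideal_at \<alpha> g y x"
proof -
  interpret H: module K "Hom C y x" using Hom_module assms by blast
  show "\<zero>\<^bsub>Hom C y x\<^esub> \<in> Ideal_at \<alpha> g y x"
    using subgroup.one_closed[OF submodule.axioms(1)[OF submodule_Ideal_at]] assms by simp
  show "\<lbrakk>f \<in> Ideal_at \<alpha> g y x; l \<in> Ideal_at \<alpha> g y x\<rbrakk> \<Longrightarrow> f \<oplus>\<^bsub>Hom C y x\<^esub> l \<in> Ideal_at \<alpha> g y x"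
    using H.submoduleE(5)[OF submodule_Ideal_at] assms by blast
qed

lemma Ideal_at_finsum:
  assumes "g \<in> carrier G" "y \<in> Obj C" "x \<in> Obj C" "\<And>i. i \<in> A \<Longrightarrow> f i \<in> Ideal_at \<alpha> g y x"
  shows "finsum (Hom C y x) f A \<in> Ideal_at \<alpha> g y x"
  by (rule finsum_additive(1)[where h = "\<lambda>f. f" and N = "Hom C y x"])
    (use assms in \<open>auto simp: Hom_monoid Ideal_at_closed intro: Ideal_at_Hom\<close>)

lemma Ideal_at_Comp:
  assumes "g \<in> carrier G" "z \<in> Obj C" "y \<in> Obj C" "x \<in> Obj C"
  shows "\<lbrakk>f \<in> carrier (Hom C z y); l \<in> Ideal_at \<alpha> g y x\<rbrakk> \<Longrightarrow> Comp C z y x f l \<in> Ideal_at \<alpha> g z x"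
    and "\<lbrakk>f \<in> Ideal_at \<alpha> g z y; l \<in> carrier (Hom C y x)\<rbrakk> \<Longrightarrow> Comp C z y x f l \<in> Ideal_at \<alpha> g z x"
  using ideals[OF assms(1)] assms by (auto simp: category_ideal_def)

lemma mor_linear:
  assumes "g \<in> carrier G" "y \<in> Dom \<alpha> (inv g)" "x \<in> Dom \<alpha> (inv g)"
  shows "f \<in> Ideal_at \<alpha> (inv g) y x \<Longrightarrow> mor \<alpha> g y x f \<in> Ideal_at \<alpha> g (act \<alpha> g y) (act \<alpha> g x)"
    and "\<lbrakk>f \<in> Ideal_at \<alpha> (inv g) y x; l \<in> Ideal_at \<alpha> (inv g) y x\<rbrakk> \<Longrightarrow>
      mor \<alpha> g y x (f \<oplus>\<^bsub>Hom C y x\<^esub> l) =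
      mor \<alpha> g y x f \<oplus>\<^bsub>Hom C (act \<alpha> g y) (act \<alpha> g x)\<^esub> mor \<alpha> g y x l"
    and "\<lbrakk>c \<in> carrier K; f \<in> Ideal_at \<alpha> (inv g) y x\<rbrakk> \<Longrightarrow>
      mor \<alpha> g y x (c \<odot>\<^bsub>Hom C y x\<^esub> f) = c \<odot>\<^bsub>Hom C (act \<alpha> g y) (act \<alpha> g x)\<^esub> mor \<alpha> g y x f"
  using mor_iso[OF assms(1,3,2)] by (auto simp: module_iso_def bij_betw_def)

lemma mor_zero:
  assumes "g \<in> carrier G" "y \<in> Dom \<alpha> (inv g)" "x \<in> Dom \<alpha> (inv g)"
  shows "mor \<alpha> g y x \<zero>\<^bsub>Hom C y x\<^esub> = \<zero>\<^bsub>Hom C (act \<alpha> g y) (act \<alpha> g x)\<^esub>"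
proof -
  have o: "y \<in> Obj C" "x \<in> Obj C" "act \<alpha> g y \<in> Obj C" "act \<alpha> g x \<in> Obj C"
    using assms Dom_Obj[of "inv g"] Dom_Obj[of g] act_closed by auto
  interpret A: module K "Hom C y x" using Hom_module o by blast
  interpret B: module K "Hom C (act \<alpha> g y) (act \<alpha> g x)" using Hom_module o by blast
  have z: "\<zero>\<^bsub>Hom C y x\<^esub> \<in> Ideal_at \<alpha> (inv g) y x" using Ideal_at_closed(1) o assms by simp
  have "mor \<alpha> g y x (\<zero>\<^bsub>K\<^esub> \<odot>\<^bsub>Hom C y x\<^esub> \<zero>\<^bsub>Hom C y x\<^esub>) = \<zero>\<^bsub>Hom C (act \<alpha> g y) (act \<alpha> g x)\<^esub>"
    using mor_linear(3)[OF assms _ z, of "\<zero>\<^bsub>K\<^esub>"] mor_linear(1)[OF assms z]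
      Ideal_at_Hom[OF assms(1) o(3,4)] by (simp del: A.smult_r_null)
  then show ?thesis by (simp del: A.smult_l_null)
qed

lemma mor_finsum:
  assumes "g \<in> carrier G" "y \<in> Dom \<alpha> (inv g)" "x \<in> Dom \<alpha> (inv g)"
    "\<And>i. i \<in> A \<Longrightarrow> f i \<in> Ideal_at \<alpha> (inv g) y x"
  shows "mor \<alpha> g y x (finsum (Hom C y x) f A) =
    finsum (Hom C (act \<alpha> g y) (act \<alpha> g x)) (\<lambda>i. mor \<alpha> g y x (f i)) A"
proof -
  have o: "y \<in> Obj C" "x \<in> Obj C" "act \<alpha> g y \<in> Obj C" "act \<alpha> g x \<in> Obj C"
    using assms Dom_Obj[of "inv g"] Dom_Obj[of g] act_closed by auto
  show ?thesis
    by (rule finsum_additive(2)[where H = "Ideal_at \<alpha> (inv g) y x"])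
      (use assms o in \<open>auto simp: Hom_monoid Ideal_at_closed mor_linear mor_zero
        intro: Ideal_at_Hom[of "inv g"] Ideal_at_Hom[of g]\<close>)
qed

text \<open>The composition axiom covers only morphisms in the image of an intersection of two
  ideals. For the pair \<open>inv g\<close>, \<open>g\<close> the two coincide, and by bijectivity
  of the map of \<open>inv g\<close> their image is all of the ideal containing \<open>f\<close>.
  The composite is then the map of \<open>\<one>\<close>.\<close>

lemma mor_inv_mor:
  assumes "g \<in> carrier G" "y \<in> Dom \<alpha> (inv g)" "x \<in> Dom \<alpha> (inv g)" "f \<in> Ideal_at \<alpha> (inv g) y x"
  shows "mor \<alpha> (inv g) (act \<alpha> g y) (act \<alpha> g x) (mor \<alpha> g y x f) = f"
proof -
  have d: "act \<alpha> g y \<in> Dom \<alpha> g" "act \<alpha> g x \<in> Dom \<alpha> g" using assms act_closed by auto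
  have "mor \<alpha> (inv g) (act \<alpha> g y) (act \<alpha> g x) ` Ideal_at \<alpha> g (act \<alpha> g y) (act \<alpha> g x) =
      Ideal_at \<alpha> (inv g) y x"
    using mor_iso[of "inv g" "act \<alpha> g x" "act \<alpha> g y"] d assms
    by (simp add: module_iso_def bij_betw_def act_inv_act)
  then have "mor \<alpha> (inv g) (act \<alpha> g y) (act \<alpha> g x) (mor \<alpha> g y x f) = mor \<alpha> \<one> y x f"
    using mor_mult[of "inv g" g "act \<alpha> g x" "act \<alpha> g y" f] assms d by (simp add: act_inv_act)
  also have "\<dots> = f"
    using assms Dom_Obj[of "inv g"] by (intro mor_one Ideal_at_Hom[of "inv g"]) auto
  finally show ?thesis .
qed

text \<open>The containment axiom, applied to \<open>inv h\<close> and \<open>inv g\<close>, turns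
  from a statement about inverse images into one about images, as in \<open>\<alpha>_inter\<close>.
  It places a composite of the skew category in the ideal of the product of the group
  elements.\<close>

lemma mor_inter:
  assumes "g \<in> carrier G" "h \<in> carrier G" "y \<in> Dom \<alpha> (inv g)" "x \<in> Dom \<alpha> (inv g)"
    "f \<in> Ideal_at \<alpha> (inv g) y x" "f \<in> Ideal_at \<alpha> h y x"
  shows "mor \<alpha> g y x f \<in> Ideal_at \<alpha> (g \<otimes> h) (act \<alpha> g y) (act \<alpha> g x)"
  using mor_inv_image[of "inv h" "inv g" x y] assms by (auto simp: inv_mult_group)

text \<open>The axioms describe the admissible \<open>f\<close> as images under the map of
  \<open>inv h\<close>. Since that map undoes the map of \<open>h\<close>, every \<open>f\<close>
  whose image lies in the second ideal has this form. The domain conditions in the second conclusion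
  ensure that the map of \<open>g\<close> is applied where \<alpha> prescribes it; membership of the
  image in the ideal does not imply them, because zero lies in every component.\<close>

lemma mor_mor:
  assumes "g \<in> carrier G" "h \<in> carrier G" "y \<in> Dom \<alpha> (inv h)" "x \<in> Dom \<alpha> (inv h)"
    "f \<in> Ideal_at \<alpha> (inv h) y x" "mor \<alpha> h y x f \<in> Ideal_at \<alpha> (inv g) (act \<alpha> h y) (act \<alpha> h x)"
  shows "f \<in> Ideal_at \<alpha> (inv (g \<otimes> h)) y x"
    and "\<lbrakk>act \<alpha> h y \<in> Dom \<alpha> (inv g); act \<alpha> h x \<in> Dom \<alpha> (inv g)\<rbrakk> \<Longrightarrow>
      mor \<alpha> g (act \<alpha> h y) (act \<alpha> h x) (mor \<alpha> h y x f) = mor \<alpha> (g \<otimes> h) y x f"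
proof -
  have d: "act \<alpha> h y \<in> Dom \<alpha> h" "act \<alpha> h x \<in> Dom \<alpha> h" using assms act_closed by auto
  have "mor \<alpha> h y x f \<in> Ideal_at \<alpha> h (act \<alpha> h y) (act \<alpha> h x)"
    using mor_linear(1) assms by blast
  then have im: "f \<in> mor \<alpha> (inv h) (act \<alpha> h y) (act \<alpha> h x) `
      (Ideal_at \<alpha> h (act \<alpha> h y) (act \<alpha> h x) \<inter> Ideal_at \<alpha> (inv g) (act \<alpha> h y) (act \<alpha> h x))"
    using mor_inv_mor[OF assms(2-5)] assms(6) by (intro image_eqI[where x = "mor \<alpha> h y x f"]) auto
  show "f \<in> Ideal_at \<alpha> (inv (g \<otimes> h)) y x"
    using mor_inv_image[OF assms(1,2) d(2,1)] im assms by (auto simp: act_inv_act)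
  show "mor \<alpha> g (act \<alpha> h y) (act \<alpha> h x) (mor \<alpha> h y x f) = mor \<alpha> (g \<otimes> h) y x f"
    if "act \<alpha> h y \<in> Dom \<alpha> (inv g)" "act \<alpha> h x \<in> Dom \<alpha> (inv g)"
    using mor_mult[OF assms(1,2) _ _ im] d that assms by (simp add: act_inv_act)
qed

section \<open>Matrices with entries in the ideals, and the maps between them\<close>

lemma induced_ideal_carrier:
  "F \<in> induced_ideal C \<alpha> g \<longleftrightarrow> F \<in> extensional (Obj C \<times> Obj C) \<and>
    (\<forall>y\<in>Obj C. \<forall>x\<in>Obj C. F (y, x) \<in> Ideal_at \<alpha> g y x)"
  using finite_Obj by (auto simp: induced_ideal_def direct_sum_simps PiE_iff)

lemma induced_ideal_entry:
  "\<lbrakk>F \<in> induced_ideal C \<alpha> g; y \<in> Obj C; x \<in> Obj C\<rbrakk> \<Longrightarrow> F (y, x) \<in> Ideal_at \<alpha> g y x"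
  by (simp add: induced_ideal_carrier)

lemma induced_ideal_entry_zero:
  "\<lbrakk>g \<in> carrier G; F \<in> induced_ideal C \<alpha> g; y \<in> Obj C; x \<in> Obj C; y \<notin> Dom \<alpha> g \<or> x \<notin> Dom \<alpha> g\<rbrakk>
    \<Longrightarrow> F (y, x) = \<zero>\<^bsub>Hom C y x\<^esub>"
  using induced_ideal_entry ideals_zero by blast

lemma induced_ideal_subset:
  "\<lbrakk>g \<in> carrier G; F \<in> induced_ideal C \<alpha> g\<rbrakk> \<Longrightarrow> F \<in> carrier (cat_algebra C)"
  using Ideal_at_Hom by (auto simp: induced_ideal_carrier cat_algebra_carrier)

lemma induced_map_apply:
  "\<lbrakk>v \<in> Obj C; w \<in> Obj C\<rbrakk> \<Longrightarrow> induced_map G C \<alpha> g F (v, w) =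
    (if v \<in> Dom \<alpha> g \<and> w \<in> Dom \<alpha> g
     then mor \<alpha> g (act \<alpha> (inv g) v) (act \<alpha> (inv g) w) (F (act \<alpha> (inv g) v, act \<alpha> (inv g) w))
     else \<zero>\<^bsub>Hom C v w\<^esub>)"
  by (simp add: induced_map_def)

lemma induced_map_entry:
  assumes "g \<in> carrier G" "y \<in> Dom \<alpha> (inv g)" "x \<in> Dom \<alpha> (inv g)"
  shows "induced_map G C \<alpha> g F (act \<alpha> g y, act \<alpha> g x) = mor \<alpha> g y x (F (y, x))"
  using assms act_closed Dom_Obj[of g] by (simp add: induced_map_apply act_inv_act)

lemma induced_map_closed:
  assumes g: "g \<in> carrier G" and F: "F \<in> induced_ideal C \<alpha> (inv g)"
  shows "induced_map G C \<alpha> g F \<in> induced_ideal C \<alpha> g"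
proof -
  have "induced_map G C \<alpha> g F (v, w) \<in> Ideal_at \<alpha> g v w" if "v \<in> Obj C" "w \<in> Obj C" for v w
  proof (cases "v \<in> Dom \<alpha> g \<and> w \<in> Dom \<alpha> g")
    case True
    then have "act \<alpha> (inv g) v \<in> Dom \<alpha> (inv g)" "act \<alpha> (inv g) w \<in> Dom \<alpha> (inv g)"
      using g act_inv_closed by auto
    then show ?thesis
      using mor_linear(1)[OF g, of "act \<alpha> (inv g) v" "act \<alpha> (inv g) w"] True g F that
        Dom_Obj[of "inv g"] by (simp add: induced_map_apply act_act_inv induced_ideal_entry)
  next
    case False
    then show ?thesis using that g by (auto simp: induced_map_apply Ideal_at_closed)
  qed
  moreover have "induced_map G C \<alpha> g F \<in> extensional (Obj C \<times> Obj C)"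
    by (simp add: induced_map_def)
  ultimately show ?thesis by (simp add: induced_ideal_carrier)
qed

lemma induced_map_one:
  assumes "F \<in> carrier (cat_algebra C)"
  shows "induced_map G C \<alpha> \<one> F = F"
proof (rule extensionalityI[of _ "Obj C \<times> Obj C"])
  fix p assume "p \<in> Obj C \<times> Obj C"
  then show "induced_map G C \<alpha> \<one> F p = F p"
    using assms by (auto simp: induced_map_apply Dom_one act_one mor_one cat_algebra_entry)
qed (use assms in \<open>auto simp: induced_map_def cat_algebra_carrier\<close>)

lemma induced_ideal_one: "induced_ideal C \<alpha> \<one> = carrier (cat_algebra C)"
  by (auto simp: induced_ideal_carrier cat_algebra_carrier Ideal_at_one)

text \<open>Where all the domain conditions hold, the claim is \<open>mor_mor\<close> entry by
  entry. At every other position both sides must be zero. On the left a zero entry is carried along;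
  on the right gh may still be defined, and the corresponding entry of \<open>F\<close> has to be
  shown to vanish.\<close>

lemma induced_map_induced_map:
  assumes g: "g \<in> carrier G" and h: "h \<in> carrier G" and F: "F \<in> induced_ideal C \<alpha> (inv h)"
    and hF: "induced_map G C \<alpha> h F \<in> induced_ideal C \<alpha> (inv g)"
  shows "F \<in> induced_ideal C \<alpha> (inv (g \<otimes> h))"
    and "induced_map G C \<alpha> g (induced_map G C \<alpha> h F) = induced_map G C \<alpha> (g \<otimes> h) F"
proof -
  \<comment> \<open>This reads the hypothesis on the image matrix at the position (hy, hx), where
    its entry is the image of the entry of \<open>F\<close> at (y, x).\<close>
  have image: "mor \<alpha> h y x (F (y, x)) \<in> Ideal_at \<alpha> (inv g) (act \<alpha> h y) (act \<alpha> h x)"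
    if "y \<in> Dom \<alpha> (inv h)" "x \<in> Dom \<alpha> (inv h)" for y x
    using induced_ideal_entry[OF hF] induced_map_entry[OF h that] that h act_closed[OF h] Dom_Obj[OF h]
    by metis
  have "F (y, x) \<in> Ideal_at \<alpha> (inv (g \<otimes> h)) y x" if "y \<in> Obj C" "x \<in> Obj C" for y x
  proof (cases "y \<in> Dom \<alpha> (inv h) \<and> x \<in> Dom \<alpha> (inv h)")
    case True
    then show ?thesis
      using mor_mor(1)[OF g h] image induced_ideal_entry[OF F] that by blast
  next
    case False
    then have "F (y, x) = \<zero>\<^bsub>Hom C y x\<^esub>"
      using induced_ideal_entry_zero[OF _ F] that h by blast
    then show ?thesis using Ideal_at_closed(1) that g h by simp
  qed
  then show Fgh: "F \<in> induced_ideal C \<alpha> (inv (g \<otimes> h))"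
    using F by (simp add: induced_ideal_carrier)
  show "induced_map G C \<alpha> g (induced_map G C \<alpha> h F) = induced_map G C \<alpha> (g \<otimes> h) F"
  proof (rule extensionalityI[of _ "Obj C \<times> Obj C"])
    fix p assume "p \<in> Obj C \<times> Obj C"
    then obtain v w where p: "p = (v, w)" and o: "v \<in> Obj C" "w \<in> Obj C" by auto
    let ?v = "act \<alpha> (inv g) v" and ?w = "act \<alpha> (inv g) w"
    let ?defined = "v \<in> Dom \<alpha> g \<and> w \<in> Dom \<alpha> g \<and> ?v \<in> Dom \<alpha> h \<and> ?w \<in> Dom \<alpha> h"
    have obj: "?v \<in> Obj C" "?w \<in> Obj C" if "v \<in> Dom \<alpha> g" "w \<in> Dom \<alpha> g"
      using that g act_inv_closed Dom_Obj[of "inv g"] by auto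
    show "induced_map G C \<alpha> g (induced_map G C \<alpha> h F) p = induced_map G C \<alpha> (g \<otimes> h) F p"
    proof (cases ?defined)
      case True
      let ?v' = "act \<alpha> (inv h) ?v" and ?w' = "act \<alpha> (inv h) ?w"
      have d: "?v' \<in> Dom \<alpha> (inv h)" "?w' \<in> Dom \<alpha> (inv h)" "?v \<in> Dom \<alpha> (inv g)" "?w \<in> Dom \<alpha> (inv g)"
        using True g h act_inv_closed by auto
      have "mor \<alpha> g (act \<alpha> h ?v') (act \<alpha> h ?w') (mor \<alpha> h ?v' ?w' (F (?v', ?w'))) =
          mor \<alpha> (g \<otimes> h) ?v' ?w' (F (?v', ?w'))"
        using d True g h
        by (intro mor_mor(2) image induced_ideal_entry[OF F])
          (auto simp: act_act_inv intro: Dom_Obj[of "inv h"])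
      moreover have "act \<alpha> h ?v' = ?v" "act \<alpha> h ?w' = ?w"
        using True h act_act_inv by auto
      ultimately show ?thesis
        using True g h o obj act_inv_act_inv[OF g h, of v] act_inv_act_inv[OF g h, of w]
        by (simp add: p induced_map_apply)
    next
      case False
      have "induced_map G C \<alpha> g (induced_map G C \<alpha> h F) p = \<zero>\<^bsub>Hom C v w\<^esub>"
      proof (cases "v \<in> Dom \<alpha> g \<and> w \<in> Dom \<alpha> g")
        case True
        then show ?thesis
          using False g o obj mor_zero[of g ?v ?w] act_inv_closed[of g v] act_inv_closed[of g w]
          by (auto simp: p induced_map_apply act_act_inv)
      next
        case False
        then show ?thesis using o by (auto simp: p induced_map_apply)
      qed
      moreover have "induced_map G C \<alpha> (g \<otimes> h) F p = \<zero>\<^bsub>Hom C v w\<^esub>"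
      proof (cases "v \<in> Dom \<alpha> (g \<otimes> h) \<and> w \<in> Dom \<alpha> (g \<otimes> h)")
        case True
        let ?a = "act \<alpha> (inv (g \<otimes> h)) v" and ?b = "act \<alpha> (inv (g \<otimes> h)) w"
        have ab: "?a \<in> Dom \<alpha> (inv (g \<otimes> h))" "?b \<in> Dom \<alpha> (inv (g \<otimes> h))"
          "act \<alpha> (g \<otimes> h) ?a = v" "act \<alpha> (g \<otimes> h) ?b = w"
          using True g h act_inv_closed[of "g \<otimes> h"] act_act_inv[of "g \<otimes> h"] by auto
        then have ab_obj: "?a \<in> Obj C" "?b \<in> Obj C"
          using g h Dom_Obj[of "inv (g \<otimes> h)"] by auto
        have "F (?a, ?b) = \<zero>\<^bsub>Hom C ?a ?b\<^esub>"
        proof (cases "?a \<in> Dom \<alpha> (inv h) \<and> ?b \<in> Dom \<alpha> (inv h)")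
          case True
          \<comment> \<open>Otherwise (v, w) would be reached from \<open>?a\<close> and
            \<open>?b\<close> by applying h and then g, and \<open>?defined\<close> would
            hold.\<close>
          have "\<not> (act \<alpha> h ?a \<in> Dom \<alpha> (inv g) \<and> act \<alpha> h ?b \<in> Dom \<alpha> (inv g))"
          proof
            assume *: "act \<alpha> h ?a \<in> Dom \<alpha> (inv g) \<and> act \<alpha> h ?b \<in> Dom \<alpha> (inv g)"
            then have "act \<alpha> g (act \<alpha> h ?a) = v" "act \<alpha> g (act \<alpha> h ?b) = w"
              using act_act(2)[OF g h] True ab by auto
            then have "v \<in> Dom \<alpha> g" "w \<in> Dom \<alpha> g" "?v = act \<alpha> h ?a" "?w = act \<alpha> h ?b"
              using * act_closed[OF g, of "act \<alpha> h ?a"] act_closed[OF g, of "act \<alpha> h ?b"]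
                act_inv_act[OF g, of "act \<alpha> h ?a"] act_inv_act[OF g, of "act \<alpha> h ?b"] by auto
            then show False using False True act_closed[OF h] by auto
          qed
          moreover have "act \<alpha> h ?a \<in> Obj C" "act \<alpha> h ?b \<in> Obj C"
            using True act_closed[OF h] Dom_Obj[OF h] by auto
          \<comment> \<open>One of the two objects lies outside the domain, so the component of the
            ideal containing this image is zero. Applying the map of \<open>inv h\<close> then shows
            that the entry itself is zero.\<close>
          ultimately have "mor \<alpha> h ?a ?b (F (?a, ?b)) = \<zero>\<^bsub>Hom C (act \<alpha> h ?a) (act \<alpha> h ?b)\<^esub>"
            using image[of ?a ?b] True ideals_zero[of "inv g" "act \<alpha> h ?a" "act \<alpha> h ?b"] g by auto
          then show ?thesis
            using mor_inv_mor[OF h, of ?a ?b "F (?a, ?b)"] induced_ideal_entry[OF F ab_obj] True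
              mor_zero[of "inv h" "act \<alpha> h ?a" "act \<alpha> h ?b"] h act_closed[OF h]
            by (simp add: act_inv_act)
        next
          case False
          then show ?thesis using induced_ideal_entry_zero[OF _ F ab_obj] h by simp
        qed
        then show ?thesis
          using True o g h mor_zero[of "g \<otimes> h" ?a ?b] ab by (simp add: p induced_map_apply)
      next
        case False
        then show ?thesis using o by (auto simp: p induced_map_apply)
      qed
      ultimately show ?thesis by simp
    qed
  qed (auto simp: induced_map_def)
qed

lemma induced_map_inverse:
  assumes "g \<in> carrier G" "F \<in> induced_ideal C \<alpha> (inv g)"
  shows "induced_map G C \<alpha> (inv g) (induced_map G C \<alpha> g F) = F"
  using induced_map_induced_map(2)[of "inv g" g F] assms induced_map_closed[of g F]
    induced_map_one induced_ideal_subset[of "inv g" F] by simp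

lemma induced_map_bij:
  assumes "g \<in> carrier G"
  shows "bij_betw (induced_map G C \<alpha> g) (induced_ideal C \<alpha> (inv g)) (induced_ideal C \<alpha> g)"
  by (rule bij_betw_byWitness[where f' = "induced_map G C \<alpha> (inv g)"])
    (use assms induced_map_inverse induced_map_inverse[of "inv g"] induced_map_closed
      induced_map_closed[of "inv g"] in auto)

text \<open>The induced ideal is itself a direct sum, of the components of the categorical ideal,
  with the operations of the matrix algebra. It is therefore a module, and inclusion makes it a
  submodule.\<close>

lemma submodule_induced_ideal:
  assumes g: "g \<in> carrier G"
  shows "submodule (induced_ideal C \<alpha> g) K (cat_algebra C)"
proof -
  interpret A: module K "cat_algebra C" by (rule module_cat_algebra)
  have "module K ((cat_algebra C)\<lparr>carrier := induced_ideal C \<alpha> g\<rparr>)"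
    by (rule module_direct_sum[OF base_cring, of "Obj C \<times> Obj C"
          "\<lambda>(y, x). (Hom C y x)\<lparr>carrier := Ideal_at \<alpha> g y x\<rparr>"])
      (use g in \<open>auto simp: induced_ideal_def cat_algebra_def direct_sum_def Ideal_at_module
        case_prod_unfold\<close>)
  then show ?thesis
    by (rule A.module_incl_imp_submodule[rotated]) (use g induced_ideal_subset in auto)
qed

lemma ideal_induced_ideal:
  assumes g: "g \<in> carrier G"
  shows "ideal (induced_ideal C \<alpha> g) (cat_algebra C)"
proof (rule idealI)
  show "ring (cat_algebra C)" using k_algebra_cat_algebra by (simp add: k_algebra_def)
  show "subgroup (induced_ideal C \<alpha> g) (add_monoid (cat_algebra C))"
    using submodule_induced_ideal[OF g] by (rule submodule.axioms)
next
  fix F L assume F: "F \<in> induced_ideal C \<alpha> g" and L: "L \<in> carrier (cat_algebra C)"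
  have "L \<otimes>\<^bsub>cat_algebra C\<^esub> F \<in> extensional (Obj C \<times> Obj C)"
    "F \<otimes>\<^bsub>cat_algebra C\<^esub> L \<in> extensional (Obj C \<times> Obj C)"
    by (simp_all add: cat_algebra_def)
  then show "L \<otimes>\<^bsub>cat_algebra C\<^esub> F \<in> induced_ideal C \<alpha> g" "F \<otimes>\<^bsub>cat_algebra C\<^esub> L \<in> induced_ideal C \<alpha> g"
    using g F L
    by (auto simp: induced_ideal_carrier[of "_ \<otimes>\<^bsub>_\<^esub> _"] cat_algebra_apply induced_ideal_entry
        cat_algebra_entry intro!: Ideal_at_finsum intro: Ideal_at_Comp)
qed

lemma induced_map_add:
  assumes g: "g \<in> carrier G" and F: "F \<in> induced_ideal C \<alpha> (inv g)" "L \<in> induced_ideal C \<alpha> (inv g)"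
  shows "induced_map G C \<alpha> g (F \<oplus>\<^bsub>cat_algebra C\<^esub> L) =
    induced_map G C \<alpha> g F \<oplus>\<^bsub>cat_algebra C\<^esub> induced_map G C \<alpha> g L"
proof (rule extensionalityI[of _ "Obj C \<times> Obj C"])
  fix p assume "p \<in> Obj C \<times> Obj C"
  then obtain v w where p: "p = (v, w)" and o: "v \<in> Obj C" "w \<in> Obj C" by auto
  show "induced_map G C \<alpha> g (F \<oplus>\<^bsub>cat_algebra C\<^esub> L) p =
    (induced_map G C \<alpha> g F \<oplus>\<^bsub>cat_algebra C\<^esub> induced_map G C \<alpha> g L) p"
  proof (cases "v \<in> Dom \<alpha> g \<and> w \<in> Dom \<alpha> g")
    case True
    then have d: "act \<alpha> (inv g) v \<in> Dom \<alpha> (inv g)" "act \<alpha> (inv g) w \<in> Dom \<alpha> (inv g)"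
      using g act_inv_closed by auto
    then have "act \<alpha> (inv g) v \<in> Obj C" "act \<alpha> (inv g) w \<in> Obj C"
      using g Dom_Obj[of "inv g"] by auto
    then show ?thesis
      using True o mor_linear(2)[OF g d] g F
      by (simp add: p induced_map_apply cat_algebra_apply act_act_inv induced_ideal_entry)
  next
    case False
    interpret H: abelian_monoid "Hom C v w" using Hom_monoid o by blast
    show ?thesis using False o by (auto simp: p induced_map_apply cat_algebra_apply)
  qed
qed (auto simp: induced_map_def cat_algebra_def direct_sum_def)

lemma induced_map_smult:
  assumes g: "g \<in> carrier G" and c: "c \<in> carrier K" and F: "F \<in> induced_ideal C \<alpha> (inv g)"
  shows "induced_map G C \<alpha> g (c \<odot>\<^bsub>cat_algebra C\<^esub> F) = c \<odot>\<^bsub>cat_algebra C\<^esub> induced_map G C \<alpha> g F"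
proof (rule extensionalityI[of _ "Obj C \<times> Obj C"])
  fix p assume "p \<in> Obj C \<times> Obj C"
  then obtain v w where p: "p = (v, w)" and o: "v \<in> Obj C" "w \<in> Obj C" by auto
  show "induced_map G C \<alpha> g (c \<odot>\<^bsub>cat_algebra C\<^esub> F) p = (c \<odot>\<^bsub>cat_algebra C\<^esub> induced_map G C \<alpha> g F) p"
  proof (cases "v \<in> Dom \<alpha> g \<and> w \<in> Dom \<alpha> g")
    case True
    then have d: "act \<alpha> (inv g) v \<in> Dom \<alpha> (inv g)" "act \<alpha> (inv g) w \<in> Dom \<alpha> (inv g)"
      using g act_inv_closed by auto
    then have "act \<alpha> (inv g) v \<in> Obj C" "act \<alpha> (inv g) w \<in> Obj C"
      using g Dom_Obj[of "inv g"] by auto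
    then show ?thesis
      using True o mor_linear(3)[OF g d c] g F
      by (simp add: p induced_map_apply cat_algebra_apply act_act_inv induced_ideal_entry)
  next
    case False
    interpret H: module K "Hom C v w" using Hom_module o by blast
    show ?thesis using False o c by (auto simp: p induced_map_apply cat_algebra_apply)
  qed
qed (auto simp: induced_map_def cat_algebra_def direct_sum_def)

text \<open>The map of \<open>g\<close> respects composition only through objects in
  \<open>Dom \<alpha> (inv g)\<close>. Each product is cut down to the objects where its terms can
  be nonzero; the two resulting sums correspond under the bijection of
  \<open>Dom \<alpha> (inv g)\<close> with \<open>Dom \<alpha> g\<close>.\<close>

lemma induced_map_mult:
  assumes g: "g \<in> carrier G" and F: "F \<in> induced_ideal C \<alpha> (inv g)" and L: "L \<in> induced_ideal C \<alpha> (inv g)"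
  shows "induced_map G C \<alpha> g (F \<otimes>\<^bsub>cat_algebra C\<^esub> L) =
    induced_map G C \<alpha> g F \<otimes>\<^bsub>cat_algebra C\<^esub> induced_map G C \<alpha> g L"
proof (rule extensionalityI[of _ "Obj C \<times> Obj C"])
  fix p assume "p \<in> Obj C \<times> Obj C"
  then obtain v w where p: "p = (v, w)" and o: "v \<in> Obj C" "w \<in> Obj C" by auto
  interpret H: abelian_monoid "Hom C v w" using Hom_monoid o by blast
  have FL: "induced_map G C \<alpha> g F \<in> carrier (cat_algebra C)" "induced_map G C \<alpha> g L \<in> carrier (cat_algebra C)"
    using g F L induced_map_closed induced_ideal_subset by auto
  have ig: "inv g \<in> carrier G" using g by simp
  show "induced_map G C \<alpha> g (F \<otimes>\<^bsub>cat_algebra C\<^esub> L) p =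
    (induced_map G C \<alpha> g F \<otimes>\<^bsub>cat_algebra C\<^esub> induced_map G C \<alpha> g L) p"
  proof (cases "v \<in> Dom \<alpha> g \<and> w \<in> Dom \<alpha> g")
    case True
    define v' w' where "v' = act \<alpha> (inv g) v" and "w' = act \<alpha> (inv g) w"
    have d: "v' \<in> Dom \<alpha> (inv g)" "w' \<in> Dom \<alpha> (inv g)" "act \<alpha> g v' = v" "act \<alpha> g w' = w"
      using True g act_inv_closed act_act_inv by (auto simp: v'_def w'_def)
    then have o': "v' \<in> Obj C" "w' \<in> Obj C"
      using Dom_Obj[OF ig] by auto
    have entry: "F (y, x) \<in> carrier (Hom C y x)" "L (y, x) \<in> carrier (Hom C y x)"
      if "y \<in> Obj C" "x \<in> Obj C" for y x
      using that F L ig by (auto intro: cat_algebra_entry induced_ideal_subset)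
    have FL_entry: "induced_map G C \<alpha> g F (v, y) \<in> carrier (Hom C v y)"
      "induced_map G C \<alpha> g L (y, w) \<in> carrier (Hom C y w)" if "y \<in> Obj C" for y
      using that o FL by (auto intro: cat_algebra_entry)
    have subset: "Dom \<alpha> (inv g) \<subseteq> Obj C" "Dom \<alpha> g \<subseteq> Obj C"
      using Dom_Obj g ig by blast+
    let ?t = "\<lambda>y. Comp C v' y w' (F (v', y)) (L (y, w'))"
    let ?u = "\<lambda>y. Comp C v y w (induced_map G C \<alpha> g F (v, y)) (induced_map G C \<alpha> g L (y, w))"
    have t: "?t y \<in> Ideal_at \<alpha> (inv g) v' w'" if "y \<in> Obj C" for y
      using that o' entry ig induced_ideal_entry[OF L] by (intro Ideal_at_Comp(1)) auto
    have "induced_map G C \<alpha> g (F \<otimes>\<^bsub>cat_algebra C\<^esub> L) p =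
        mor \<alpha> g v' w' (finsum (Hom C v' w') ?t (Obj C))"
      using True o o' by (simp add: p induced_map_apply v'_def w'_def cat_algebra_apply)
    \<comment> \<open>For the omitted \<open>y\<close> the right factor \<open>L (y, w')\<close>
      lies in a zero component of the ideal.\<close>
    also have "finsum (Hom C v' w') ?t (Obj C) = finsum (Hom C v' w') ?t (Dom \<alpha> (inv g))"
    proof (rule abelian_monoid.finsum_mono_neutral[OF Hom_monoid, symmetric])
      fix y assume y: "y \<in> Obj C - Dom \<alpha> (inv g)"
      then show "?t y = \<zero>\<^bsub>Hom C v' w'\<^esub>"
        using o' entry induced_ideal_entry_zero[OF ig L, of y w']
        by (simp add: Comp_zero_right)
    next
      fix y assume "y \<in> Dom \<alpha> (inv g)"
      then show "?t y \<in> carrier (Hom C v' w')"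
        using o' entry subset by (intro Comp_closed) auto
    qed (use o' finite_Obj subset in auto)
    also have "mor \<alpha> g v' w' \<dots> = finsum (Hom C v w) (\<lambda>y. mor \<alpha> g v' w' (?t y)) (Dom \<alpha> (inv g))"
      using mor_finsum[OF g d(1,2), of "Dom \<alpha> (inv g)" ?t] t d subset by auto
    also have "\<dots> = finsum (Hom C v w) (\<lambda>y. ?u (act \<alpha> g y)) (Dom \<alpha> (inv g))"
    proof (rule H.finsum_cong')
      fix y assume y: "y \<in> Dom \<alpha> (inv g)"
      have "mor \<alpha> g v' w' (?t y) = Comp C (act \<alpha> g v') (act \<alpha> g y) (act \<alpha> g w')
          (mor \<alpha> g v' y (F (v', y))) (mor \<alpha> g y w' (L (y, w')))"
        using y d o' subset by (intro mor_Comp g induced_ideal_entry[OF F] induced_ideal_entry[OF L]) auto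
      also have "\<dots> = ?u (act \<alpha> g y)"
        using induced_map_entry[OF g d(1) y, of F] induced_map_entry[OF g y d(2), of L] d by simp
      finally show "mor \<alpha> g v' w' (?t y) = ?u (act \<alpha> g y)" .
    qed (use o subset act_closed[OF g] in \<open>auto intro!: Comp_closed FL_entry\<close>)
    also have "\<dots> = finsum (Hom C v w) ?u (act \<alpha> g ` Dom \<alpha> (inv g))"
    proof (rule H.finsum_reindex[symmetric])
      show "inj_on (act \<alpha> g) (Dom \<alpha> (inv g))"
        using act_inv_act[OF g] by (metis inj_onI)
    qed (use o subset act_closed[OF g] in \<open>auto intro!: Comp_closed FL_entry\<close>)
    also have "act \<alpha> g ` Dom \<alpha> (inv g) = Dom \<alpha> g"
      using objects g by (simp add: partial_action_set_def bij_betw_def)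
    also have "finsum (Hom C v w) ?u (Dom \<alpha> g) = finsum (Hom C v w) ?u (Obj C)"
    proof (rule H.finsum_mono_neutral)
      fix y assume "y \<in> Obj C - Dom \<alpha> g"
      then show "?u y = \<zero>\<^bsub>Hom C v w\<^esub>"
        using o FL cat_algebra_entry
          induced_ideal_entry_zero[OF g induced_map_closed[OF g L], of y w]
        by (simp add: Comp_zero_right)
    qed (use o finite_Obj subset in \<open>auto intro!: Comp_closed FL_entry\<close>)
    also have "\<dots> = (induced_map G C \<alpha> g F \<otimes>\<^bsub>cat_algebra C\<^esub> induced_map G C \<alpha> g L) p"
      using o by (simp add: p cat_algebra_apply)
    finally show ?thesis .
  next
    case False
    \<comment> \<open>Membership of the product in the ideal forces its entry at this position to be
      zero, so the sum need not be examined.\<close>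
    have "induced_map G C \<alpha> g F \<otimes>\<^bsub>cat_algebra C\<^esub> induced_map G C \<alpha> g L \<in> induced_ideal C \<alpha> g"
      using ideal.I_r_closed[OF ideal_induced_ideal[OF g]] induced_map_closed[OF g F] FL by blast
    then have "(induced_map G C \<alpha> g F \<otimes>\<^bsub>cat_algebra C\<^esub> induced_map G C \<alpha> g L) p = \<zero>\<^bsub>Hom C v w\<^esub>"
      unfolding p by (rule induced_ideal_entry_zero[OF g _ o]) (use False in blast)
    then show ?thesis using False o by (auto simp: p induced_map_apply)
  qed
qed (auto simp: induced_map_def cat_algebra_def)

lemma partial_action_cat_algebra:
  "partial_action_algebra K G (cat_algebra C) (induced_ideal C \<alpha>) (induced_map G C \<alpha>)"
  unfolding partial_action_algebra_def partial_action_set_def algebra_iso_def module_iso_def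
  using k_algebra_cat_algebra induced_ideal_subset induced_map_bij induced_ideal_one induced_map_one
    induced_map_induced_map ideal_induced_ideal submodule_induced_ideal induced_map_add
    induced_map_smult induced_map_mult
  by (auto simp: subset_iff)

end

section \<open>The isomorphism\<close>

sublocale finite_partial_action \<subseteq>
  skew_group: partial_algebra_action K G "cat_algebra C" "induced_ideal C \<alpha>" "induced_map G C \<alpha>"
  by unfold_locales (rule partial_action_cat_algebra)

context finite_partial_action
begin

section \<open>Morphisms and composition of the skew category\<close>

abbreviation "S \<equiv> skew_category G C \<alpha>"

abbreviation "D \<equiv> defined_at G \<alpha>"

lemma in_defined_at: "g \<in> D x \<longleftrightarrow> g \<in> carrier G \<and> x \<in> Dom \<alpha> (inv g)"
  by (simp add: defined_at_def)

lemma defined_at_carrier: "g \<in> D x \<Longrightarrow> g \<in> carrier G"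
  by (simp add: in_defined_at)

lemma act_defined_at:
  assumes "g \<in> D x"
  shows "act \<alpha> g x \<in> Dom \<alpha> g" "act \<alpha> g x \<in> Obj C"
  using assms act_closed[of g x] Dom_Obj[of g "act \<alpha> g x"] by (auto simp: in_defined_at)

lemma defined_at_mult:
  assumes "t \<in> carrier G" "g \<in> D x" "act \<alpha> g x \<in> Dom \<alpha> (inv t)"
  shows "t \<otimes> g \<in> D x" "act \<alpha> t (act \<alpha> g x) = act \<alpha> (t \<otimes> g) x"
  using assms act_act[of t g x] by (auto simp: in_defined_at)

lemma skew_Obj [simp]: "Obj S = Obj C"
  by (simp add: skew_category_def)

lemma skew_Hom_carrier:
  "F \<in> carrier (Hom S y x) \<longleftrightarrow> F \<in> extensional (D x) \<and>
    (\<forall>g\<in>D x. F g \<in> Ideal_at \<alpha> g y (act \<alpha> g x)) \<and>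
    finite {g \<in> D x. F g \<noteq> \<zero>\<^bsub>Hom C y (act \<alpha> g x)\<^esub>}"
  by (auto simp: skew_category_def direct_sum_simps PiE_iff)

lemma skew_Hom_entry: "\<lbrakk>F \<in> carrier (Hom S y x); g \<in> D x\<rbrakk> \<Longrightarrow> F g \<in> Ideal_at \<alpha> g y (act \<alpha> g x)"
  by (simp add: skew_Hom_carrier)

lemma skew_Hom_apply:
  assumes "g \<in> D x"
  shows "\<zero>\<^bsub>Hom S y x\<^esub> g = \<zero>\<^bsub>Hom C y (act \<alpha> g x)\<^esub>"
    and "(F \<oplus>\<^bsub>Hom S y x\<^esub> L) g = F g \<oplus>\<^bsub>Hom C y (act \<alpha> g x)\<^esub> L g"
    and "(c \<odot>\<^bsub>Hom S y x\<^esub> F) g = c \<odot>\<^bsub>Hom C y (act \<alpha> g x)\<^esub> F g"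
  using assms by (simp_all add: skew_category_def direct_sum_simps)

lemma module_skew_Hom:
  assumes "y \<in> Obj C" "x \<in> Obj C"
  shows "module K (Hom S y x)"
  by (rule module_direct_sum[OF base_cring, of "D x"
        "\<lambda>g. (Hom C y (act \<alpha> g x))\<lparr>carrier := Ideal_at \<alpha> g y (act \<alpha> g x)\<rparr>"])
    (use assms in \<open>auto simp: skew_category_def intro!: Ideal_at_module act_defined_at
      dest: defined_at_carrier\<close>)

text \<open>The inner composite of a skew product inherits the ideal of \<open>inv t\<close> from
  its left factor and that of \<open>g\<close> from its right factor. The first membership allows
  the map of \<open>t\<close> to be applied, the second places the result in the ideal of the
  product, through \<open>mor_inter\<close>.\<close>

lemma Comp_mor_inv:
  assumes t: "t \<in> carrier G" and z: "z \<in> Dom \<alpha> t" and y: "y \<in> Dom \<alpha> (inv t)" and x: "x \<in> Obj C"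
    and f: "f \<in> Ideal_at \<alpha> t z (act \<alpha> t y)"
  shows "l \<in> carrier (Hom C y x) \<Longrightarrow>
      Comp C (act \<alpha> (inv t) z) y x (mor \<alpha> (inv t) z (act \<alpha> t y) f) l
        \<in> Ideal_at \<alpha> (inv t) (act \<alpha> (inv t) z) x"
    and "\<lbrakk>g \<in> carrier G; l \<in> Ideal_at \<alpha> g y x\<rbrakk> \<Longrightarrow>
      Comp C (act \<alpha> (inv t) z) y x (mor \<alpha> (inv t) z (act \<alpha> t y) f) l
        \<in> Ideal_at \<alpha> g (act \<alpha> (inv t) z) x"
proof -
  have o: "act \<alpha> (inv t) z \<in> Obj C" "y \<in> Obj C"
    using t z y act_inv_closed Dom_Obj[of "inv t"] by auto
  have m: "mor \<alpha> (inv t) z (act \<alpha> t y) f \<in> Ideal_at \<alpha> (inv t) (act \<alpha> (inv t) z) y"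
    using mor_linear(1)[of "inv t" z "act \<alpha> t y" f] t z y f act_closed[of t y]
    by (simp add: act_inv_act)
  show "l \<in> carrier (Hom C y x) \<Longrightarrow>
      Comp C (act \<alpha> (inv t) z) y x (mor \<alpha> (inv t) z (act \<alpha> t y) f) l
        \<in> Ideal_at \<alpha> (inv t) (act \<alpha> (inv t) z) x"
    using Ideal_at_Comp(2)[of "inv t"] t o x m by auto
  show "\<lbrakk>g \<in> carrier G; l \<in> Ideal_at \<alpha> g y x\<rbrakk> \<Longrightarrow>
      Comp C (act \<alpha> (inv t) z) y x (mor \<alpha> (inv t) z (act \<alpha> t y) f) l
        \<in> Ideal_at \<alpha> g (act \<alpha> (inv t) z) x"
    using Ideal_at_Comp(1)[of g] Ideal_at_Hom[OF _ o m] t o x by auto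
qed

text \<open>The assumption that the product is defined at \<open>x\<close> gives the target
  component a meaning even when it cannot be reached in two steps. In that case the composite is the
  default zero, which lies in every component.\<close>

lemma skew_comp_closed:
  assumes t: "t \<in> D y" and g: "g \<in> D x" and tg: "t \<otimes> g \<in> D x" and z: "z \<in> Obj C"
    and f: "f \<in> Ideal_at \<alpha> t z (act \<alpha> t y)" and l: "l \<in> Ideal_at \<alpha> g y (act \<alpha> g x)"
  shows "skew_comp G C \<alpha> z y x t g f l \<in> Ideal_at \<alpha> (t \<otimes> g) z (act \<alpha> (t \<otimes> g) x)"
proof (cases "z \<in> Dom \<alpha> t \<and> act \<alpha> g x \<in> Dom \<alpha> (inv t)")
  case True
  have tG: "t \<in> carrier G" and y: "y \<in> Dom \<alpha> (inv t)" and gG: "g \<in> carrier G"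
    using t g by (auto simp: in_defined_at)
  then have yO: "y \<in> Obj C" using Dom_Obj[of "inv t"] by simp
  let ?c = "Comp C (act \<alpha> (inv t) z) y (act \<alpha> g x) (mor \<alpha> (inv t) z (act \<alpha> t y) f) l"
  have "mor \<alpha> t (act \<alpha> (inv t) z) (act \<alpha> g x) ?c \<in>
      Ideal_at \<alpha> (t \<otimes> g) (act \<alpha> t (act \<alpha> (inv t) z)) (act \<alpha> t (act \<alpha> g x))"
  proof (rule mor_inter[OF tG gG])
    show "?c \<in> Ideal_at \<alpha> (inv t) (act \<alpha> (inv t) z) (act \<alpha> g x)"
      using True tG y f Ideal_at_Hom[OF gG yO _ l] act_defined_at[OF g]
      by (intro Comp_mor_inv(1)) auto
    show "?c \<in> Ideal_at \<alpha> g (act \<alpha> (inv t) z) (act \<alpha> g x)"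
      using True tG gG y f l act_defined_at[OF g] by (intro Comp_mor_inv(2)) auto
  qed (use True tG act_inv_closed in auto)
  then show ?thesis
    using True tG defined_at_mult(2)[OF tG g] by (simp add: skew_comp_def act_act_inv)
next
  case False
  then show ?thesis
    using Ideal_at_closed(1)[OF _ z act_defined_at(2)[OF tg]] defined_at_carrier[OF tg]
    by (auto simp: skew_comp_def)
qed

lemma skew_Comp_apply:
  assumes "s \<in> D x"
  shows "Comp S z y x F L s = finsum (Hom C z (act \<alpha> s x))
    (\<lambda>(t, g). skew_comp G C \<alpha> z y x t g (F t) (L g))
    {(t, g). t \<in> D y \<and> g \<in> D x \<and>
      F t \<noteq> \<zero>\<^bsub>Hom C z (act \<alpha> t y)\<^esub> \<and> L g \<noteq> \<zero>\<^bsub>Hom C y (act \<alpha> g x)\<^esub> \<and> t \<otimes> g = s}"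
  using assms by (simp add: skew_category_def)

lemma skew_Comp_closed:
  assumes o: "x \<in> Obj C" "y \<in> Obj C" "z \<in> Obj C"
    and F: "F \<in> carrier (Hom S z y)" and L: "L \<in> carrier (Hom S y x)"
  shows "Comp S z y x F L \<in> carrier (Hom S z x)"
  unfolding skew_Hom_carrier
proof (intro conjI ballI)
  let ?A = "{t \<in> D y. F t \<noteq> \<zero>\<^bsub>Hom C z (act \<alpha> t y)\<^esub>}" and ?B = "{g \<in> D x. L g \<noteq> \<zero>\<^bsub>Hom C y (act \<alpha> g x)\<^esub>}"
  show "Comp S z y x F L \<in> extensional (D x)"
    by (simp add: skew_category_def)
  show "Comp S z y x F L s \<in> Ideal_at \<alpha> s z (act \<alpha> s x)" if s: "s \<in> D x" for s
    unfolding skew_Comp_apply[OF s]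
    using skew_comp_closed[OF _ _ _ o(3) skew_Hom_entry[OF F] skew_Hom_entry[OF L]] s o
    by (intro Ideal_at_finsum) (auto simp: act_defined_at dest: defined_at_carrier)
  show "finite {s \<in> D x. Comp S z y x F L s \<noteq> \<zero>\<^bsub>Hom C z (act \<alpha> s x)\<^esub>}"
  proof (rule finite_subset)
    show "{s \<in> D x. Comp S z y x F L s \<noteq> \<zero>\<^bsub>Hom C z (act \<alpha> s x)\<^esub>} \<subseteq> (\<lambda>(t, g). t \<otimes> g) ` (?A \<times> ?B)"
    proof
      fix s assume "s \<in> {s \<in> D x. Comp S z y x F L s \<noteq> \<zero>\<^bsub>Hom C z (act \<alpha> s x)\<^esub>}"
      then have s: "s \<in> D x" "Comp S z y x F L s \<noteq> \<zero>\<^bsub>Hom C z (act \<alpha> s x)\<^esub>" by auto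
      let ?P = "{(t, g). t \<in> D y \<and> g \<in> D x \<and> F t \<noteq> \<zero>\<^bsub>Hom C z (act \<alpha> t y)\<^esub> \<and>
        L g \<noteq> \<zero>\<^bsub>Hom C y (act \<alpha> g x)\<^esub> \<and> t \<otimes> g = s}"
      interpret H: abelian_monoid "Hom C z (act \<alpha> s x)"
        using Hom_monoid o act_defined_at[OF s(1)] by blast
      have "?P \<noteq> {}"
      proof
        assume empty: "?P = {}"
        show False using s(2) unfolding skew_Comp_apply[OF s(1)] empty by (simp add: H.finsum_empty)
      qed
      then show "s \<in> (\<lambda>(t, g). t \<otimes> g) ` (?A \<times> ?B)" by force
    qed
    show "finite ((\<lambda>(t, g). t \<otimes> g) ` (?A \<times> ?B))"
      using F L by (auto simp: skew_Hom_carrier)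
  qed
qed

end

sublocale finite_partial_action \<subseteq> skew_cat: finite_module_graph K "skew_category G C \<alpha>"
  by (intro finite_module_graph.intro base_cring)
    (simp_all add: finite_Obj module_skew_Hom skew_Comp_closed)

context finite_partial_action
begin

section \<open>The linear bijection between the two algebras\<close>

abbreviation "A \<equiv> cat_algebra (skew_category G C \<alpha>)"

abbreviation "B \<equiv> partial_skew_group_algebra G (cat_algebra C) (induced_ideal C \<alpha>) (induced_map G C \<alpha>)"

lemma skew_entry:
  "\<lbrakk>F \<in> carrier A; y \<in> Obj C; x \<in> Obj C; g \<in> D x\<rbrakk> \<Longrightarrow> F (y, x) g \<in> Ideal_at \<alpha> g y (act \<alpha> g x)"
  using skew_cat.cat_algebra_entry skew_Hom_entry by simp

text \<open>The columns of the coefficient are indexed by the target object \<open>w\<close>, so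
  \<open>F\<close> is read at the source \<open>act \<alpha> (inv g) w\<close>, available just when
  \<open>w\<close> is in the range of \<open>g\<close>.\<close>

definition to_skew_group :: "('o \<times> 'o \<Rightarrow> 'g \<Rightarrow> 'm) \<Rightarrow> 'g \<Rightarrow> 'o \<times> 'o \<Rightarrow> 'm"
  where "to_skew_group F = (\<lambda>g\<in>carrier G. \<lambda>(z, w)\<in>Obj C \<times> Obj C.
    if w \<in> Dom \<alpha> g then F (z, act \<alpha> (inv g) w) g else \<zero>\<^bsub>Hom C z w\<^esub>)"

definition of_skew_group :: "('g \<Rightarrow> 'o \<times> 'o \<Rightarrow> 'm) \<Rightarrow> 'o \<times> 'o \<Rightarrow> 'g \<Rightarrow> 'm"
  where "of_skew_group a = (\<lambda>(z, x)\<in>Obj C \<times> Obj C. \<lambda>g\<in>D x. a g (z, act \<alpha> g x))"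

lemma to_skew_group_apply:
  "\<lbrakk>g \<in> carrier G; z \<in> Obj C; w \<in> Obj C\<rbrakk> \<Longrightarrow> to_skew_group F g (z, w) =
    (if w \<in> Dom \<alpha> g then F (z, act \<alpha> (inv g) w) g else \<zero>\<^bsub>Hom C z w\<^esub>)"
  by (simp add: to_skew_group_def)

lemma to_skew_group_act:
  "\<lbrakk>g \<in> D x; z \<in> Obj C\<rbrakk> \<Longrightarrow> to_skew_group F g (z, act \<alpha> g x) = F (z, x) g"
  using act_defined_at by (simp add: to_skew_group_apply in_defined_at act_inv_act)

lemma defined_at_act_inv: "\<lbrakk>g \<in> carrier G; w \<in> Dom \<alpha> g\<rbrakk> \<Longrightarrow> g \<in> D (act \<alpha> (inv g) w)"
  using act_inv_closed by (simp add: in_defined_at)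

lemma act_inv_Obj: "\<lbrakk>g \<in> carrier G; w \<in> Dom \<alpha> g\<rbrakk> \<Longrightarrow> act \<alpha> (inv g) w \<in> Obj C"
  using act_inv_closed Dom_Obj[of "inv g"] by simp

lemma to_skew_group_ideal:
  assumes F: "F \<in> carrier A" and g: "g \<in> carrier G"
  shows "to_skew_group F g \<in> induced_ideal C \<alpha> g"
proof -
  have "to_skew_group F g (z, w) \<in> Ideal_at \<alpha> g z w" if "z \<in> Obj C" "w \<in> Obj C" for z w
    using that g skew_entry[OF F, of z "act \<alpha> (inv g) w" g] defined_at_act_inv[of g w] act_inv_Obj[of g w]
    by (auto simp: to_skew_group_apply act_act_inv Ideal_at_closed)
  then show ?thesis using g by (simp add: induced_ideal_carrier to_skew_group_def)
qed

text \<open>A nonzero coefficient at \<open>g\<close> has a nonzero entry, which is the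
  \<open>g\<close>-component of some entry of \<open>F\<close>. So the support is covered by the
  supports of the entries of \<open>F\<close>, which are finitely many finite sets.\<close>

lemma to_skew_group_closed:
  assumes F: "F \<in> carrier A"
  shows "to_skew_group F \<in> carrier B"
proof -
  let ?supp = "\<lambda>y x. {g \<in> D x. F (y, x) g \<noteq> \<zero>\<^bsub>Hom C y (act \<alpha> g x)\<^esub>}"
  have "finite {g \<in> carrier G. to_skew_group F g \<noteq> \<zero>\<^bsub>cat_algebra C\<^esub>}"
  proof (rule finite_subset)
    show "{g \<in> carrier G. to_skew_group F g \<noteq> \<zero>\<^bsub>cat_algebra C\<^esub>} \<subseteq> (\<Union>y\<in>Obj C. \<Union>x\<in>Obj C. ?supp y x)"
    proof
      fix g assume "g \<in> {g \<in> carrier G. to_skew_group F g \<noteq> \<zero>\<^bsub>cat_algebra C\<^esub>}"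
      then have g: "g \<in> carrier G" "to_skew_group F g \<noteq> \<zero>\<^bsub>cat_algebra C\<^esub>" by auto
      obtain z w where o: "z \<in> Obj C" "w \<in> Obj C" and nz: "to_skew_group F g (z, w) \<noteq> \<zero>\<^bsub>Hom C z w\<^esub>"
        using g cat_algebra_eqI[of "to_skew_group F g" "\<zero>\<^bsub>cat_algebra C\<^esub>"]
          induced_ideal_subset[OF g(1) to_skew_group_ideal[OF F g(1)]]
          induced_ideal_subset[OF g(1) skew_group.S_zero[OF g(1)]]
        by (metis cat_algebra_apply(1))
      then have w: "w \<in> Dom \<alpha> g"
        using g by (auto simp: to_skew_group_apply split: if_splits)
      then have "g \<in> ?supp z (act \<alpha> (inv g) w)"
        using nz o g by (simp add: to_skew_group_apply defined_at_act_inv act_act_inv)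
      then show "g \<in> (\<Union>y\<in>Obj C. \<Union>x\<in>Obj C. ?supp y x)"
        using o act_inv_Obj[OF g(1) w] by blast
    qed
    show "finite (\<Union>y\<in>Obj C. \<Union>x\<in>Obj C. ?supp y x)"
    proof (intro finite_UN_I finite_Obj)
      fix y x assume "y \<in> Obj C" "x \<in> Obj C"
      then have "F (y, x) \<in> carrier (Hom S y x)" using skew_cat.cat_algebra_entry[OF F] by simp
      then show "finite (?supp y x)" by (simp add: skew_Hom_carrier)
    qed
  qed
  then show ?thesis
    using to_skew_group_ideal[OF F] by (auto simp: skew_group.skew_carrier to_skew_group_def PiE_iff)
qed

lemma of_skew_group_apply:
  "\<lbrakk>z \<in> Obj C; x \<in> Obj C; g \<in> D x\<rbrakk> \<Longrightarrow> of_skew_group a (z, x) g = a g (z, act \<alpha> g x)"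
  by (simp add: of_skew_group_def)

lemma of_skew_group_closed:
  assumes a: "a \<in> carrier B"
  shows "of_skew_group a \<in> carrier A"
proof -
  have "of_skew_group a (z, x) \<in> carrier (Hom S z x)" if o: "z \<in> Obj C" "x \<in> Obj C" for z x
    unfolding skew_Hom_carrier
  proof (intro conjI ballI)
    show "of_skew_group a (z, x) \<in> extensional (D x)" using o by (simp add: of_skew_group_def)
    show "of_skew_group a (z, x) g \<in> Ideal_at \<alpha> g z (act \<alpha> g x)" if g: "g \<in> D x" for g
      using o g induced_ideal_entry[OF skew_group.skew_entry[OF a defined_at_carrier[OF g]]]
        act_defined_at[OF g] by (simp add: of_skew_group_apply)
    show "finite {g \<in> D x. of_skew_group a (z, x) g \<noteq> \<zero>\<^bsub>Hom C z (act \<alpha> g x)\<^esub>}"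
    proof (rule finite_subset)
      \<comment> \<open>Each component of the entry is itself an entry of the matrix
        \<open>a g\<close>, so it can be nonzero only if that matrix is.\<close>
      show "{g \<in> D x. of_skew_group a (z, x) g \<noteq> \<zero>\<^bsub>Hom C z (act \<alpha> g x)\<^esub>} \<subseteq> skew_group.support a"
        using o act_defined_at
        by (auto simp: skew_group.support_def of_skew_group_apply cat_algebra_apply
            dest: defined_at_carrier)
    qed (use skew_group.finite_support[OF a] in simp)
  qed
  moreover have "of_skew_group a \<in> extensional (Obj C \<times> Obj C)" by (simp add: of_skew_group_def)
  ultimately show ?thesis by (simp add: skew_cat.cat_algebra_carrier)
qed

lemma to_of_skew_group:
  assumes a: "a \<in> carrier B"
  shows "to_skew_group (of_skew_group a) = a"
proof (rule skew_group.skew_eqI)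
  show "to_skew_group (of_skew_group a) \<in> carrier B"
    using a of_skew_group_closed to_skew_group_closed by blast
  fix g assume g: "g \<in> carrier G"
  have ag: "a g \<in> induced_ideal C \<alpha> g" using skew_group.skew_entry[OF a g] .
  show "to_skew_group (of_skew_group a) g = a g"
  proof (rule cat_algebra_eqI)
    show "to_skew_group (of_skew_group a) g \<in> carrier (cat_algebra C)"
      using induced_ideal_subset[OF g to_skew_group_ideal[OF of_skew_group_closed[OF a] g]] .
    show "a g \<in> carrier (cat_algebra C)" using induced_ideal_subset[OF g ag] .
    fix z w assume o: "z \<in> Obj C" "w \<in> Obj C"
    show "to_skew_group (of_skew_group a) g (z, w) = a g (z, w)"
      \<comment> \<open>When \<open>w\<close> is outside \<open>Dom \<alpha> g\<close>, the left
        side is zero by definition and the right side because \<open>a g\<close> lies in the ideal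
        of \<open>g\<close>.\<close>
      using o g induced_ideal_entry_zero[OF g ag o]
      by (simp add: to_skew_group_apply of_skew_group_apply defined_at_act_inv act_inv_Obj act_act_inv)
  qed
qed (rule a)

lemma of_to_skew_group:
  assumes F: "F \<in> carrier A"
  shows "of_skew_group (to_skew_group F) = F"
proof (rule skew_cat.cat_algebra_eqI)
  have c: "of_skew_group (to_skew_group F) \<in> carrier A"
    using F of_skew_group_closed to_skew_group_closed by blast
  then show "of_skew_group (to_skew_group F) \<in> carrier A" .
  fix z x assume "z \<in> Obj S" "x \<in> Obj S"
  then have o: "z \<in> Obj C" "x \<in> Obj C" by simp_all
  show "of_skew_group (to_skew_group F) (z, x) = F (z, x)"
  proof (rule extensionalityI[of _ "D x"])
    fix g assume "g \<in> D x"
    then show "of_skew_group (to_skew_group F) (z, x) g = F (z, x) g"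
      using o by (simp add: of_skew_group_apply to_skew_group_act)
  qed (use o skew_cat.cat_algebra_entry[OF F] skew_cat.cat_algebra_entry[OF c] in
      \<open>simp_all add: skew_Hom_carrier\<close>)
qed (rule F)

lemma to_skew_group_bij: "bij_betw to_skew_group (carrier A) (carrier B)"
  by (rule bij_betw_byWitness[where f' = of_skew_group])
    (auto simp: to_of_skew_group of_to_skew_group to_skew_group_closed of_skew_group_closed)

lemma to_skew_group_add:
  assumes F: "F \<in> carrier A" and L: "L \<in> carrier A"
  shows "to_skew_group (F \<oplus>\<^bsub>A\<^esub> L) = to_skew_group F \<oplus>\<^bsub>B\<^esub> to_skew_group L"
proof -
  interpret A: module K A by (rule skew_cat.module_cat_algebra)
  interpret B: module K B by (rule skew_group.module_skew)
  show ?thesis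
  proof (rule skew_group.skew_eqI)
    fix g assume g: "g \<in> carrier G"
    have c: "to_skew_group F g \<in> carrier (cat_algebra C)" "to_skew_group L g \<in> carrier (cat_algebra C)"
      "to_skew_group (F \<oplus>\<^bsub>A\<^esub> L) g \<in> carrier (cat_algebra C)"
      using F L g by (auto intro!: induced_ideal_subset[OF g] to_skew_group_ideal)
    have "to_skew_group (F \<oplus>\<^bsub>A\<^esub> L) g = to_skew_group F g \<oplus>\<^bsub>cat_algebra C\<^esub> to_skew_group L g"
    proof (rule cat_algebra_eqI[OF c(3) skew_group.R.M.a_closed[OF c(1,2)]])
      fix z w assume o: "z \<in> Obj C" "w \<in> Obj C"
      interpret H: abelian_monoid "Hom C z w" using Hom_monoid o by blast
      show "to_skew_group (F \<oplus>\<^bsub>A\<^esub> L) g (z, w) =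
        (to_skew_group F g \<oplus>\<^bsub>cat_algebra C\<^esub> to_skew_group L g) (z, w)"
        using g o by (simp add: to_skew_group_apply cat_algebra_apply skew_cat.cat_algebra_apply
            act_inv_Obj skew_Hom_apply defined_at_act_inv act_act_inv)
    qed
    then show "to_skew_group (F \<oplus>\<^bsub>A\<^esub> L) g = (to_skew_group F \<oplus>\<^bsub>B\<^esub> to_skew_group L) g"
      using g by (simp add: skew_group.skew_apply)
  qed (use F L in \<open>auto intro!: to_skew_group_closed\<close>)
qed

lemma to_skew_group_smult:
  assumes k: "k \<in> carrier K" and F: "F \<in> carrier A"
  shows "to_skew_group (k \<odot>\<^bsub>A\<^esub> F) = k \<odot>\<^bsub>B\<^esub> to_skew_group F"
proof -
  interpret A: module K A by (rule skew_cat.module_cat_algebra)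
  interpret B: module K B by (rule skew_group.module_skew)
  show ?thesis
  proof (rule skew_group.skew_eqI)
    fix g assume g: "g \<in> carrier G"
    have c: "to_skew_group F g \<in> carrier (cat_algebra C)"
      "to_skew_group (k \<odot>\<^bsub>A\<^esub> F) g \<in> carrier (cat_algebra C)"
      using F k g by (auto intro!: induced_ideal_subset[OF g] to_skew_group_ideal)
    have "to_skew_group (k \<odot>\<^bsub>A\<^esub> F) g = k \<odot>\<^bsub>cat_algebra C\<^esub> to_skew_group F g"
    proof (rule cat_algebra_eqI[OF c(2) skew_group.R.smult_closed[OF k c(1)]])
      fix z w assume o: "z \<in> Obj C" "w \<in> Obj C"
      interpret H: module K "Hom C z w" using Hom_module o by blast
      show "to_skew_group (k \<odot>\<^bsub>A\<^esub> F) g (z, w) = (k \<odot>\<^bsub>cat_algebra C\<^esub> to_skew_group F g) (z, w)"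
        using g o k by (simp add: to_skew_group_apply cat_algebra_apply skew_cat.cat_algebra_apply
            act_inv_Obj skew_Hom_apply defined_at_act_inv act_act_inv)
    qed
    then show "to_skew_group (k \<odot>\<^bsub>A\<^esub> F) g = (k \<odot>\<^bsub>B\<^esub> to_skew_group F) g"
      using g by (simp add: skew_group.skew_apply)
  qed (use F k in \<open>auto intro!: to_skew_group_closed\<close>)
qed

text \<open>
  The contribution to the entry at \<open>(z, w)\<close> of either product that comes from the \<open>t\<close>-component of \<open>F\<close>,
  the \<open>g\<close>-component of \<open>L\<close>, and the intermediate object \<open>y\<close>.
\<close>

definition contribution :: "('o \<times> 'o \<Rightarrow> 'g \<Rightarrow> 'm) \<Rightarrow> ('o \<times> 'o \<Rightarrow> 'g \<Rightarrow> 'm) \<Rightarrow> 'o \<Rightarrow> 'o \<Rightarrow> 'o \<Rightarrow> 'g \<Rightarrow> 'g \<Rightarrow> 'm"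
  where "contribution F L z w y t g =
    (if z \<in> Dom \<alpha> t \<and> w \<in> Dom \<alpha> t \<and> act \<alpha> (inv t) w \<in> Dom \<alpha> g \<and> y \<in> Dom \<alpha> (inv t)
     then mor \<alpha> t (act \<alpha> (inv t) z) (act \<alpha> (inv t) w)
       (Comp C (act \<alpha> (inv t) z) y (act \<alpha> (inv t) w) (mor \<alpha> (inv t) z (act \<alpha> t y) (F (z, y) t))
         (L (y, act \<alpha> (inv g) (act \<alpha> (inv t) w)) g))
     else \<zero>\<^bsub>Hom C z w\<^esub>)"

section \<open>Multiplicativity of the bijection\<close>

context
  fixes F L
  assumes F: "F \<in> carrier A" and L: "L \<in> carrier A"
begin

lemma contribution_closed:
  assumes t: "t \<in> carrier G" and g: "g \<in> carrier G" and o: "z \<in> Obj C" "w \<in> Obj C"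
  shows "contribution F L z w y t g \<in> carrier (Hom C z w)"
proof (cases "z \<in> Dom \<alpha> t \<and> w \<in> Dom \<alpha> t \<and> act \<alpha> (inv t) w \<in> Dom \<alpha> g \<and> y \<in> Dom \<alpha> (inv t)")
  case True
  let ?w = "act \<alpha> (inv t) w"
  have yO: "y \<in> Obj C" using True t Dom_Obj[of "inv t"] by simp
  have wO: "?w \<in> Obj C" "act \<alpha> (inv g) ?w \<in> Obj C" using True t g act_inv_Obj by auto
  have l: "L (y, act \<alpha> (inv g) ?w) g \<in> carrier (Hom C y ?w)"
    using skew_entry[OF L yO wO(2) defined_at_act_inv[OF g]] True g
    by (intro Ideal_at_Hom[OF g yO wO(1)]) (simp add: act_act_inv)
  have "Comp C (act \<alpha> (inv t) z) y ?w (mor \<alpha> (inv t) z (act \<alpha> t y) (F (z, y) t))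
      (L (y, act \<alpha> (inv g) ?w) g) \<in> Ideal_at \<alpha> (inv t) (act \<alpha> (inv t) z) ?w"
    using True t o yO wO l by (intro Comp_mor_inv(1) skew_entry[OF F]) (auto simp: in_defined_at)
  then have "contribution F L z w y t g \<in> Ideal_at \<alpha> t z w"
    using mor_linear(1)[OF t, of "act \<alpha> (inv t) z" ?w] True t act_inv_closed[OF t]
    by (simp add: contribution_def act_act_inv)
  then show ?thesis using Ideal_at_Hom t o by blast
next
  case False
  then show ?thesis using Hom_zero o by (auto simp: contribution_def)
qed

text \<open>The composition of the skew category checks definedness forward from the source
  \<open>x\<close>, the contribution backward from the target. Given that
  \<open>t \<otimes> g\<close> is defined at \<open>x\<close>, the two checks agree.\<close>

lemma skew_comp_contribution:
  assumes t: "t \<in> D y" and g: "g \<in> D x" and tg: "t \<otimes> g \<in> D x"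
  shows "skew_comp G C \<alpha> z y x t g (F (z, y) t) (L (y, x) g) =
    contribution F L z (act \<alpha> (t \<otimes> g) x) y t g"
proof -
  let ?w = "act \<alpha> (t \<otimes> g) x"
  have G: "t \<in> carrier G" "g \<in> carrier G" using t g by (auto dest: defined_at_carrier)
  show ?thesis
  proof (cases "z \<in> Dom \<alpha> t \<and> act \<alpha> g x \<in> Dom \<alpha> (inv t)")
    case True
    then have w: "act \<alpha> t (act \<alpha> g x) = ?w" using defined_at_mult G g by simp
    then have "?w \<in> Dom \<alpha> t" "act \<alpha> (inv t) ?w = act \<alpha> g x"
      using True G act_closed[of t "act \<alpha> g x"] act_inv_act[of t "act \<alpha> g x"] by simp_all
    then show ?thesis
      using True t g G act_defined_at[OF g]
      by (simp add: skew_comp_def contribution_def in_defined_at act_inv_act)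
  next
    case False
    \<comment> \<open>Going back from \<open>?w\<close> along \<open>inv t\<close> and
      \<open>inv g\<close> would lead to \<open>x\<close>. So \<open>act \<alpha> g x\<close> would
      be \<open>act \<alpha> (inv t) ?w\<close>, hence in the domain of \<open>t\<close>, and the
      case assumption would fail.\<close>
    have "\<not> (z \<in> Dom \<alpha> t \<and> ?w \<in> Dom \<alpha> t \<and> act \<alpha> (inv t) ?w \<in> Dom \<alpha> g)"
    proof
      assume *: "z \<in> Dom \<alpha> t \<and> ?w \<in> Dom \<alpha> t \<and> act \<alpha> (inv t) ?w \<in> Dom \<alpha> g"
      then have "act \<alpha> (inv g) (act \<alpha> (inv t) ?w) = x"
        using act_inv_act_inv(2)[OF G, of ?w] act_inv_act[of "t \<otimes> g" x] tg
        by (simp add: in_defined_at)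
      then have "act \<alpha> g x = act \<alpha> (inv t) ?w"
        using act_act_inv[OF G(2), of "act \<alpha> (inv t) ?w"] * by simp
      then show False using False * act_inv_closed[OF G(1)] by simp
    qed
    then show ?thesis using False by (auto simp: skew_comp_def contribution_def)
  qed
qed

text \<open>If either component is zero, then so is the composite, and the linear map of
  \<open>t\<close> preserves zero. Contrapositively, every nonzero contribution comes from a pair
  that the composition of the skew category already sums over.\<close>

lemma contribution_support:
  assumes t: "t \<in> carrier G" and g: "g \<in> carrier G" and o: "z \<in> Obj C" "w \<in> Obj C"
    and nz: "contribution F L z w y t g \<noteq> \<zero>\<^bsub>Hom C z w\<^esub>" and x: "x = act \<alpha> (inv (t \<otimes> g)) w"
  shows "t \<in> D y" "g \<in> D x" "F (z, y) t \<noteq> \<zero>\<^bsub>Hom C z (act \<alpha> t y)\<^esub>" "L (y, x) g \<noteq> \<zero>\<^bsub>Hom C y (act \<alpha> g x)\<^esub>"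
proof -
  let ?z = "act \<alpha> (inv t) z" and ?w = "act \<alpha> (inv t) w"
  have c: "z \<in> Dom \<alpha> t" "w \<in> Dom \<alpha> t" "?w \<in> Dom \<alpha> g" "y \<in> Dom \<alpha> (inv t)"
    using nz by (auto simp: contribution_def split: if_splits)
  have x': "x = act \<alpha> (inv g) ?w" using act_inv_act_inv(2)[OF t g c(2,3)] x by simp
  show tD: "t \<in> D y" using t c by (simp add: in_defined_at)
  show gD: "g \<in> D x" using x' g c defined_at_act_inv by simp
  have gx: "act \<alpha> g x = ?w" using x' g c by (simp add: act_act_inv)
  have oo: "?z \<in> Obj C" "?w \<in> Obj C" "y \<in> Obj C" "x \<in> Obj C" "act \<alpha> t y \<in> Obj C"
    using c t g x' act_inv_Obj Dom_Obj[of "inv t" y] act_defined_at[OF tD] by auto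
  have d: "?z \<in> Dom \<alpha> (inv t)" "?w \<in> Dom \<alpha> (inv t)" using c t act_inv_closed by auto
  have eq: "contribution F L z w y t g =
      mor \<alpha> t ?z ?w (Comp C ?z y ?w (mor \<alpha> (inv t) z (act \<alpha> t y) (F (z, y) t)) (L (y, x) g))"
    using c x' by (simp add: contribution_def)
  have zero: "mor \<alpha> t ?z ?w \<zero>\<^bsub>Hom C ?z ?w\<^esub> = \<zero>\<^bsub>Hom C z w\<^esub>"
    using mor_zero[OF t d] c t by (simp add: act_act_inv)
  have l: "L (y, x) g \<in> carrier (Hom C y ?w)"
    using skew_entry[OF L oo(3,4) gD] Ideal_at_Hom[OF g] oo gx by simp
  have m: "mor \<alpha> (inv t) z (act \<alpha> t y) f \<in> carrier (Hom C ?z y)"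
    if "f \<in> Ideal_at \<alpha> t z (act \<alpha> t y)" for f
    using mor_linear(1)[of "inv t" z "act \<alpha> t y" f] that t c act_defined_at[OF tD]
      Ideal_at_Hom[of "inv t" ?z y] oo by (simp add: act_inv_act)
  show "F (z, y) t \<noteq> \<zero>\<^bsub>Hom C z (act \<alpha> t y)\<^esub>"
  proof
    assume "F (z, y) t = \<zero>\<^bsub>Hom C z (act \<alpha> t y)\<^esub>"
    then show False
      using nz eq zero mor_zero[of "inv t" z "act \<alpha> t y"] t c act_defined_at[OF tD] l oo
      by (simp add: act_inv_act Comp_zero_left)
  qed
  show "L (y, x) g \<noteq> \<zero>\<^bsub>Hom C y (act \<alpha> g x)\<^esub>"
  proof
    assume "L (y, x) g = \<zero>\<^bsub>Hom C y (act \<alpha> g x)\<^esub>"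
    then show False
      using nz eq zero m[OF skew_entry[OF F o(1) oo(3) tD]] oo gx
      by (simp add: Comp_zero_right)
  qed
qed

lemma support_to_skew_group:
  assumes "N \<in> carrier A" "g \<in> D x" "y \<in> Obj C" "N (y, x) g \<noteq> \<zero>\<^bsub>Hom C y (act \<alpha> g x)\<^esub>"
  shows "g \<in> skew_group.support (to_skew_group N)"
proof -
  have "to_skew_group N g (y, act \<alpha> g x) \<noteq> \<zero>\<^bsub>cat_algebra C\<^esub> (y, act \<alpha> g x)"
    using assms act_defined_at by (simp add: to_skew_group_act cat_algebra_apply)
  then show ?thesis
    using assms by (auto simp: skew_group.support_def dest: defined_at_carrier)
qed

text \<open>The pairs in the definition of composition depend on the intermediate object
  \<open>y\<close>, which would block an exchange of sums. The supports of the two image formal sums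
  contain all of them for every \<open>y\<close>, are finite, and add only zero terms.\<close>

lemma skew_Comp_contribution:
  assumes o: "x \<in> Obj C" "y \<in> Obj C" "z \<in> Obj C" and s: "s \<in> D x"
  shows "Comp S z y x (F (z, y)) (L (y, x)) s =
    finsum (Hom C z (act \<alpha> s x)) (\<lambda>(t, g). contribution F L z (act \<alpha> s x) y t g)
      {(t, g) \<in> skew_group.support (to_skew_group F) \<times> skew_group.support (to_skew_group L). t \<otimes> g = s}"
proof -
  let ?w = "act \<alpha> s x"
  let ?T = "skew_group.support (to_skew_group F)" and ?U = "skew_group.support (to_skew_group L)"
  let ?P = "{(t, g). t \<in> D y \<and> g \<in> D x \<and> F (z, y) t \<noteq> \<zero>\<^bsub>Hom C z (act \<alpha> t y)\<^esub> \<and>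
      L (y, x) g \<noteq> \<zero>\<^bsub>Hom C y (act \<alpha> g x)\<^esub> \<and> t \<otimes> g = s}"
  let ?Q = "{(t, g) \<in> ?T \<times> ?U. t \<otimes> g = s}"
  have w: "?w \<in> Obj C" "act \<alpha> (inv s) ?w = x"
    using s act_defined_at act_inv_act by (auto simp: in_defined_at)
  interpret H: abelian_monoid "Hom C z ?w" using Hom_monoid o w by blast
  have "Comp S z y x (F (z, y)) (L (y, x)) s =
      finsum (Hom C z ?w) (\<lambda>(t, g). contribution F L z ?w y t g) ?P"
    unfolding skew_Comp_apply[OF s]
    using s o w by (intro H.finsum_cong')
      (auto simp: skew_comp_contribution intro!: contribution_closed dest: defined_at_carrier)
  also have "\<dots> = finsum (Hom C z ?w) (\<lambda>(t, g). contribution F L z ?w y t g) ?Q"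
  proof (rule H.finsum_mono_neutral)
    have "finite (?T \<times> ?U)"
      using F L to_skew_group_closed skew_group.finite_support by simp
    then show "finite ?Q" by (rule finite_subset[rotated]) auto
    show "?P \<subseteq> ?Q"
      using support_to_skew_group F L o by auto
    fix p assume "p \<in> ?Q - ?P"
    then obtain t g where p: "p = (t, g)" "t \<in> carrier G" "g \<in> carrier G" "t \<otimes> g = s" "(t, g) \<notin> ?P"
      by (auto dest!: skew_group.in_support)
    then have "contribution F L z ?w y t g = \<zero>\<^bsub>Hom C z ?w\<^esub>"
      using contribution_support[OF p(2,3) o(3) w(1), of y x] w(2) by auto
    then show "(case p of (t, g) \<Rightarrow> contribution F L z ?w y t g) = \<zero>\<^bsub>Hom C z ?w\<^esub>"
      using p(1) by simp
  next
    fix p assume "p \<in> ?P"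
    then show "(case p of (t, g) \<Rightarrow> contribution F L z ?w y t g) \<in> carrier (Hom C z ?w)"
      using o w by (auto intro!: contribution_closed dest: defined_at_carrier)
  qed
  finally show ?thesis .
qed

text \<open>Every term of the inner matrix product lies in the ideal of \<open>inv t\<close>, where
  the map of \<open>t\<close> is additive, so this map can be applied termwise. What remains is to
  match each term with its contribution.\<close>

lemma skew_term_contribution:
  assumes t: "t \<in> carrier G" and g: "g \<in> carrier G" and o: "z \<in> Obj C" "w \<in> Obj C"
  shows "skew_group.skew_term t (to_skew_group F t) (to_skew_group L g) (z, w) =
    finsum (Hom C z w) (\<lambda>y. contribution F L z w y t g) (Obj C)"
proof (cases "z \<in> Dom \<alpha> t \<and> w \<in> Dom \<alpha> t")
  case True
  let ?z = "act \<alpha> (inv t) z" and ?w = "act \<alpha> (inv t) w"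
  let ?F = "induced_map G C \<alpha> (inv t) (to_skew_group F t)"
  let ?c = "\<lambda>y. Comp C ?z y ?w (?F (?z, y)) (to_skew_group L g (y, ?w))"
  interpret H: abelian_monoid "Hom C z w" using Hom_monoid o by blast
  have oo: "?z \<in> Obj C" "?w \<in> Obj C" using True t act_inv_Obj by auto
  have d: "?z \<in> Dom \<alpha> (inv t)" "?w \<in> Dom \<alpha> (inv t)" using True t act_inv_closed by auto
  have Fi: "?F \<in> induced_ideal C \<alpha> (inv t)"
    using induced_map_closed[of "inv t"] to_skew_group_ideal[OF F t] t by simp
  have F': "?F (?z, y) \<in> Ideal_at \<alpha> (inv t) ?z y" if "y \<in> Obj C" for y
    using induced_ideal_entry[OF Fi] oo that by simp
  then have F'': "?F (?z, y) \<in> carrier (Hom C ?z y)" if "y \<in> Obj C" for y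
    using Ideal_at_Hom[of "inv t"] t oo that by simp
  have L': "to_skew_group L g (y, ?w) \<in> carrier (Hom C y ?w)" if "y \<in> Obj C" for y
    using induced_ideal_subset[OF g to_skew_group_ideal[OF L g]] oo that by (intro cat_algebra_entry)
  have "skew_group.skew_term t (to_skew_group F t) (to_skew_group L g) (z, w) =
      mor \<alpha> t ?z ?w (finsum (Hom C ?z ?w) ?c (Obj C))"
    using True o oo by (simp add: skew_group.skew_term_def induced_map_apply cat_algebra_apply)
  also have "\<dots> = finsum (Hom C z w) (\<lambda>y. mor \<alpha> t ?z ?w (?c y)) (Obj C)"
    using mor_finsum[OF t d, of "Obj C" ?c] F' L' Ideal_at_Comp(2)[of "inv t"] t oo True
    by (simp add: act_act_inv)
  also have "\<dots> = finsum (Hom C z w) (\<lambda>y. contribution F L z w y t g) (Obj C)"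
  proof (rule H.finsum_cong')
    fix y assume y: "y \<in> Obj C"
    have zero: "mor \<alpha> t ?z ?w \<zero>\<^bsub>Hom C ?z ?w\<^esub> = \<zero>\<^bsub>Hom C z w\<^esub>"
      using mor_zero[OF t d] True t by (simp add: act_act_inv)
    show "mor \<alpha> t ?z ?w (?c y) = contribution F L z w y t g"
    proof (cases "y \<in> Dom \<alpha> (inv t) \<and> ?w \<in> Dom \<alpha> g")
      case c: True
      then have tD: "t \<in> D y" using t by (simp add: in_defined_at)
      have "?F (?z, y) = mor \<alpha> (inv t) z (act \<alpha> t y) (F (z, y) t)"
        using c d y oo t True to_skew_group_act[OF tD o(1), of F]
        by (simp add: induced_map_apply act_act_inv)
      then show ?thesis
        using c True y oo g by (simp add: contribution_def to_skew_group_apply)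
    next
      \<comment> \<open>The contribution is zero by definition here. On the other side a factor
        vanishes: the right one when \<open>?w\<close> is outside \<open>Dom \<alpha> g\<close>, the
        left one when \<open>y\<close> is outside \<open>Dom \<alpha> (inv t)\<close>.\<close>
      case c: False
      have "?c y = \<zero>\<^bsub>Hom C ?z ?w\<^esub>"
      proof (cases "y \<in> Dom \<alpha> (inv t)")
        case True
        then show ?thesis
          using c y oo g F'' by (simp add: to_skew_group_apply Comp_zero_right)
      next
        case False
        then show ?thesis
          using y oo t L' by (simp add: induced_map_apply Comp_zero_left)
      qed
      then show ?thesis using c zero by (auto simp: contribution_def)
    qed
  qed (use t g o contribution_closed in auto)
  finally show ?thesis .
next
  case False
  interpret H: abelian_monoid "Hom C z w" using Hom_monoid o by blast
  have "finsum (Hom C z w) (\<lambda>y. contribution F L z w y t g) (Obj C) = \<zero>\<^bsub>Hom C z w\<^esub>"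
    using False by (intro H.finsum_zero_eqI) (auto simp: contribution_def)
  then show ?thesis
    using False o by (auto simp: skew_group.skew_term_def induced_map_apply)
qed

text \<open>In \<open>A\<close> the outer sum runs over the intermediate object and the inner one
  over factorisations of \<open>s\<close>; in \<open>B\<close> they are nested the other way. The
  set \<open>?Q\<close> does not depend on the object, so the two sums may be exchanged.\<close>

lemma to_skew_group_mult: "to_skew_group (F \<otimes>\<^bsub>A\<^esub> L) = to_skew_group F \<otimes>\<^bsub>B\<^esub> to_skew_group L"
proof (rule skew_group.skew_eqI)
  have FL: "F \<otimes>\<^bsub>A\<^esub> L \<in> carrier A" using F L by (rule skew_cat.cat_algebra_mult_closed)
  show cA: "to_skew_group (F \<otimes>\<^bsub>A\<^esub> L) \<in> carrier B" using FL by (rule to_skew_group_closed)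
  have bF: "to_skew_group F \<in> carrier B" and bL: "to_skew_group L \<in> carrier B"
    using F L to_skew_group_closed by auto
  show cB: "to_skew_group F \<otimes>\<^bsub>B\<^esub> to_skew_group L \<in> carrier B"
    using bF bL by (rule skew_group.skew_mult_closed)
  fix s assume s: "s \<in> carrier G"
  have iB: "(to_skew_group F \<otimes>\<^bsub>B\<^esub> to_skew_group L) s \<in> induced_ideal C \<alpha> s"
    using skew_group.skew_entry[OF cB s] .
  let ?T = "skew_group.support (to_skew_group F)" and ?U = "skew_group.support (to_skew_group L)"
  let ?Q = "{(t, g) \<in> ?T \<times> ?U. t \<otimes> g = s}"
  show "to_skew_group (F \<otimes>\<^bsub>A\<^esub> L) s = (to_skew_group F \<otimes>\<^bsub>B\<^esub> to_skew_group L) s"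
  proof (rule cat_algebra_eqI)
    show "to_skew_group (F \<otimes>\<^bsub>A\<^esub> L) s \<in> carrier (cat_algebra C)"
      using induced_ideal_subset[OF s to_skew_group_ideal[OF FL s]] .
    show "(to_skew_group F \<otimes>\<^bsub>B\<^esub> to_skew_group L) s \<in> carrier (cat_algebra C)"
      using induced_ideal_subset[OF s iB] .
    fix z w assume o: "z \<in> Obj C" "w \<in> Obj C"
    interpret H: abelian_monoid "Hom C z w" using Hom_monoid o by blast
    show "to_skew_group (F \<otimes>\<^bsub>A\<^esub> L) s (z, w) = (to_skew_group F \<otimes>\<^bsub>B\<^esub> to_skew_group L) s (z, w)"
    proof (cases "w \<in> Dom \<alpha> s")
      case True
      define x where "x = act \<alpha> (inv s) w"
      have x: "x \<in> Obj C" "s \<in> D x" "act \<alpha> s x = w"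
        using True s act_inv_Obj defined_at_act_inv act_act_inv by (auto simp: x_def)
      have comp: "Comp S z y x (F (z, y)) (L (y, x)) \<in> carrier (Hom S z x)" if "y \<in> Obj C" for y
        using that o x F L skew_cat.cat_algebra_entry by (intro skew_Comp_closed) auto
      have "to_skew_group (F \<otimes>\<^bsub>A\<^esub> L) s (z, w) = (F \<otimes>\<^bsub>A\<^esub> L) (z, x) s"
        using to_skew_group_act[OF x(2) o(1)] x by simp
      also have "\<dots> = (finsum (Hom S z x) (\<lambda>y. Comp S z y x (F (z, y)) (L (y, x))) (Obj C)) s"
        using o x by (simp add: skew_cat.cat_algebra_apply)
      \<comment> \<open>Evaluation of a morphism of the skew category at \<open>s\<close> is
        additive, so it passes inside the sum.\<close>
      also have "\<dots> = finsum (Hom C z w) (\<lambda>y. Comp S z y x (F (z, y)) (L (y, x)) s) (Obj C)"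
        by (rule finsum_additive(2)[where H = "carrier (Hom S z x)" and h = "\<lambda>l. l s"])
          (use o x s comp skew_cat.Hom_monoid[of x z] H.abelian_monoid_axioms in
            \<open>auto simp: skew_Hom_apply abelian_monoid.zero_closed abelian_monoid.a_closed
              intro: Ideal_at_Hom[OF s] dest!: skew_Hom_entry[OF _ x(2)]\<close>)
      also have "\<dots> = finsum (Hom C z w)
          (\<lambda>y. finsum (Hom C z w) (\<lambda>(t, g). contribution F L z w y t g) ?Q) (Obj C)"
        using skew_Comp_contribution[OF x(1) _ o(1) x(2), unfolded x(3)] o
        by (intro H.finsum_cong') (auto intro!: H.finsum_closed contribution_closed
            dest!: skew_group.in_support)
      also have "\<dots> = finsum (Hom C z w)
          (\<lambda>p. finsum (Hom C z w) (\<lambda>y. case p of (t, g) \<Rightarrow> contribution F L z w y t g) (Obj C)) ?Q"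
        using o by (intro H.finsum_commute) (auto intro!: contribution_closed dest!: skew_group.in_support)
      also have "\<dots> = finsum (Hom C z w)
          (\<lambda>p. (case p of (t, g) \<Rightarrow> skew_group.skew_term t (to_skew_group F t) (to_skew_group L g)) (z, w)) ?Q"
        using o by (intro H.finsum_cong') (auto simp: skew_term_contribution
            intro!: contribution_closed H.finsum_closed dest!: skew_group.in_support)
      \<comment> \<open>Conversely, reading off the entry at (z, w) is additive and is now taken out
        of the sum.\<close>
      also have "\<dots> = (finsum (cat_algebra C)
          (\<lambda>(t, g). skew_group.skew_term t (to_skew_group F t) (to_skew_group L g)) ?Q) (z, w)"
        by (rule finsum_additive(2)[where H = "carrier (cat_algebra C)" and h = "\<lambda>l. l (z, w)", symmetric])
          (use o bF bL H.abelian_monoid_axioms skew_group.R.M.abelian_monoid_axioms in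
            \<open>auto simp: cat_algebra_apply cat_algebra_entry abelian_monoid.zero_closed
              abelian_monoid.a_closed intro!: skew_group.skew_term_entry_R dest!: skew_group.in_support\<close>)
      also have "\<dots> = (to_skew_group F \<otimes>\<^bsub>B\<^esub> to_skew_group L) s (z, w)"
        using bF bL s by (subst skew_group.skew_mult_apply[OF bF bL s, of ?T ?U])
          (auto simp: skew_group.finite_support dest: skew_group.in_support)
      finally show ?thesis .
    next
      \<comment> \<open>Column \<open>w\<close> is zero on the left by definition, and on the right
        because the coefficient lies in the ideal of \<open>s\<close>.\<close>
      case False
      then show ?thesis
        using s o induced_ideal_entry_zero[OF s iB o] by (simp add: to_skew_group_apply)
    qed
  qed
qed

end

section \<open>Transport of the algebra structure and conclusion\<close>

lemma algebra_iso_to_skew_group: "algebra_iso K A B to_skew_group"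
  unfolding algebra_iso_def module_iso_def
  using to_skew_group_bij to_skew_group_add to_skew_group_smult to_skew_group_mult by blast

text \<open>An injective map that respects sums, scalar multiples and products pulls the bilinear
  laws of \<open>B\<close> back to \<open>A\<close>. Only closure under the product is established
  directly on the side of the skew category.\<close>

lemma nonassoc_algebra_skew_cat: "nonassoc_algebra K A"
proof -
  interpret A: module K A by (rule skew_cat.module_cat_algebra)
  interpret B: nonassoc_algebra K B by (rule skew_group.nonassoc_algebra_skew)
  have inj: "F = L" if "F \<in> carrier A" "L \<in> carrier A" "to_skew_group F = to_skew_group L" for F L
    using that of_to_skew_group by metis
  note closed = skew_cat.cat_algebra_mult_closed to_skew_group_closed
  note hom = to_skew_group_add to_skew_group_smult to_skew_group_mult
  show ?thesis
    by (intro nonassoc_algebra.intro A.module_axioms nonassoc_algebra_axioms.intro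
        skew_cat.cat_algebra_mult_closed; (assumption | rule inj))
      (simp_all add: closed hom B.mult_add_left B.mult_add_right B.mult_smult_left B.mult_smult_right)
qed

end

theorem theorem3p9:
  fixes K :: "('k, 'c) ring_scheme"
    and G :: "('g, 'd) monoid_scheme"
    and C :: "('o, 'k, 'm) wnna_cat"
    and \<alpha> :: "('g, 'o, 'm) partial_action_data"
  assumes "cring K"
    and "group G"
    and "k_category K C"
    and "finite (Obj C)"
    and "partial_action_category K G C \<alpha>"
  shows "partial_action_algebra K G (cat_algebra C) (induced_ideal C \<alpha>) (induced_map G C \<alpha>) \<and>
    nonassoc_algebra K (cat_algebra (skew_category G C \<alpha>)) \<and>
    nonassoc_algebra K (partial_skew_group_algebra G (cat_algebra C) (induced_ideal C \<alpha>) (induced_map G C \<alpha>)) \<and>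
    algebras_isomorphic K
      (cat_algebra (skew_category G C \<alpha>))
      (partial_skew_group_algebra G (cat_algebra C) (induced_ideal C \<alpha>) (induced_map G C \<alpha>))"
proof -
  interpret finite_partial_action K G C \<alpha>
    using assms(4,5) by (intro finite_partial_action.intro finite_partial_action_axioms.intro)
  show ?thesis
    using partial_action_cat_algebra nonassoc_algebra_skew_cat skew_group.nonassoc_algebra_skew
      algebra_iso_to_skew_group
    unfolding algebras_isomorphic_def by blast
qed

end
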